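(* Let $N\ge 2$, let $\Omega\subset\mathbb{R}^N$ be open, and let $\Phi$ be a Young function such that $\Phi\in\Delta'$ and $\tilde{\Phi}\in\Delta'$, and such that $\int_0^1\left(\frac{s}{\Phi(s)}\right)^{\frac{1}{N-1}}ds<\infty$ in case $|\Omega|=\infty$. Assume that $B_\Phi=\Phi_N\circ\Phi^{-1}$ is a Young function. If $g\in L^{\tilde{B}_\Phi}(\Omega)$, then there exists a constant $C=C(N,\Phi)>0$ such that \[ \int_\Omega |g(x)|\,\Phi(|u(x)|)\,dx\le C\,\|g\|_{L^{\tilde{B}_\Phi}(\Omega)}\int_\Omega \Phi(|\nabla u(x)|)\,dx\qquad\forall\,u\in \mathcal{C}^1_c(\Omega). \]
   Context: A Young function is $\Phi(t)=\int_0^t\varphi(s)\,ds$ ($t\ge0$), where $\varphi$ is increasing, right continuous on $[0,\infty)$ with $\varphi(t)=0$ iff $t=0$. Its complementary function is $\tilde{\Phi}(t)=\sup_{s>0}\{st-\Phi(s)\}$. $\Phi\in\Delta_2$ means $\Phi(2t)\le C\Phi(t)$ for all $t\ge0$ for some $C>1$; $\Phi\in\Delta'$ means $\Phi(st)\le C\Phi(s)\Phi(t)$ for all $s,t\ge0$ for some $C>1$. Throughout the paper all Young functions considered are assumed to satisfy $\Delta_2$. With $N'=\frac{N}{N-1}$, $H_\Phi(t)=\int_0^t\frac{\tilde\Phi(s)}{s^{1+N'}}ds$ and $H_\Phi^{-1}$ its inverse, define $\Phi_N(t)=\int_0^t s^{N'-1}\big(H_\Phi^{-1}(s^{N'})\big)^{N'}ds$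 for $t\ge 0$. For a Young function $A$, $L^{A}(\Omega)$ is the Orlicz space of measurable $u$ with $\int_\Omega A(|u|/\lambda)dx<\infty$ for some $\lambda>0$, normed by the Luxemburg norm $\|u\|_{L^A(\Omega)}=\inf\{\lambda>0:\int_\Omega A(|u|/\lambda)\,dx\le1\}$; $\tilde{B}_\Phi$ is the complementary function of $B_\Phi$. *)

theory Defs
  imports "HOL-Analysis.Analysis"
begin

definition young_function :: "(real \<Rightarrow> real) \<Rightarrow> bool" where
  "young_function \<Phi> \<longleftrightarrow>
     (\<exists>\<phi>. mono_on {0..} \<phi> \<and> (\<forall>t\<ge>0. continuous (at_right t) \<phi>) \<and>
          (\<forall>t\<ge>0. \<phi> t = 0 \<longleftrightarrow> t = 0) \<and>
          (\<forall>t\<ge>0. \<Phi> t = integral {0..t} \<phi>))"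

definition delta2 :: "(real \<Rightarrow> real) \<Rightarrow> bool" where
  "delta2 \<Phi> \<longleftrightarrow> (\<exists>C>1. \<forall>t\<ge>0. \<Phi> (2 * t) \<le> C * \<Phi> t)"

definition delta_prime :: "(real \<Rightarrow> real) \<Rightarrow> bool" where
  "delta_prime \<Phi> \<longleftrightarrow> (\<exists>C>1. \<forall>s\<ge>0. \<forall>t\<ge>0. \<Phi> (s * t) \<le> C * \<Phi> s * \<Phi> t)"

definition young_conj :: "(real \<Rightarrow> real) \<Rightarrow> real \<Rightarrow> ennreal" where
  "young_conj \<Phi> t = (SUP s\<in>{0<..}. ennreal (s * t - \<Phi> s))"

definition delta_prime_e :: "(real \<Rightarrow> ennreal) \<Rightarrow> bool" where
  "delta_prime_e F \<longleftrightarrow> (\<forall>t\<ge>0. F t < \<infinity>) \<and>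
     (\<exists>C>1. \<forall>s\<ge>0. \<forall>t\<ge>0. F (s * t) \<le> ennreal C * F s * F t)"

definition young_inv :: "(real \<Rightarrow> real) \<Rightarrow> real \<Rightarrow> real" where
  "young_inv \<Phi> s = (THE t. 0 \<le> t \<and> \<Phi> t = s)"

definition conj_exp :: "nat \<Rightarrow> real" where
  "conj_exp N = real N / (real N - 1)"

definition H_fun :: "nat \<Rightarrow> (real \<Rightarrow> real) \<Rightarrow> real \<Rightarrow> ennreal" where
  "H_fun N \<Phi> t = (\<integral>\<^sup>+ s\<in>{0<..t}. young_conj \<Phi> s / ennreal (s powr (1 + conj_exp N)) \<partial>lborel)"

text \<open>(H_Phi^{-1}(r))^(N'), with H_Phi^{-1}(r) = inf {t >= 0. H_Phi(t) >= r}
  (the inverse of the continuous increasing function H_Phi; +oo if r is not attained).\<close>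
definition H_inv_pow :: "nat \<Rightarrow> (real \<Rightarrow> real) \<Rightarrow> real \<Rightarrow> ennreal" where
  "H_inv_pow N \<Phi> r = (INF t\<in>{t. 0 \<le> t \<and> ennreal r \<le> H_fun N \<Phi> t}. ennreal (t powr conj_exp N))"

definition Phi_N :: "nat \<Rightarrow> (real \<Rightarrow> real) \<Rightarrow> real \<Rightarrow> ennreal" where
  "Phi_N N \<Phi> t = (\<integral>\<^sup>+ s\<in>{0..t}.
       ennreal (s powr (conj_exp N - 1)) * H_inv_pow N \<Phi> (s powr conj_exp N) \<partial>lborel)"

definition B_Phi :: "nat \<Rightarrow> (real \<Rightarrow> real) \<Rightarrow> real \<Rightarrow> ennreal" where
  "B_Phi N \<Phi> t = Phi_N N \<Phi> (young_inv \<Phi> t)"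

definition B_Phi_real :: "nat \<Rightarrow> (real \<Rightarrow> real) \<Rightarrow> real \<Rightarrow> real" where
  "B_Phi_real N \<Phi> t = enn2real (B_Phi N \<Phi> t)"

definition orlicz_space :: "(real \<Rightarrow> ennreal) \<Rightarrow> ('a::euclidean_space) set \<Rightarrow> ('a \<Rightarrow> real) set" where
  "orlicz_space A \<Omega> = {u. u \<in> borel_measurable (lebesgue_on \<Omega>) \<and>
      (\<exists>c>0. (\<integral>\<^sup>+ x\<in>\<Omega>. A (\<bar>u x\<bar> / c) \<partial>lebesgue) < \<infinity>)}"

definition luxemburg_norm :: "(real \<Rightarrow> ennreal) \<Rightarrow> ('a::euclidean_space) set \<Rightarrow> ('a \<Rightarrow> real) \<Rightarrow> real" where
  "luxemburg_norm A \<Omega> u = Inf {c. c > 0 \<and> (\<integral>\<^sup>+ x\<in>\<Omega>. A (\<bar>u x\<bar> / c) \<partial>lebesgue) \<le> 1}"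

text \<open>u (extended by zero outside Omega) is C^1 on R^N with gradient Du, and its
  support is a compact subset of Omega.\<close>
definition C1c_with_grad :: "('a::euclidean_space) set \<Rightarrow> ('a \<Rightarrow> real) \<Rightarrow> ('a \<Rightarrow> 'a) \<Rightarrow> bool" where
  "C1c_with_grad \<Omega> u Du \<longleftrightarrow>
     (\<forall>x. (u has_derivative (\<lambda>h. Du x \<bullet> h)) (at x)) \<and> continuous_on UNIV Du \<and>
     compact (closure {x. u x \<noteq> 0}) \<and> closure {x. u x \<noteq> 0} \<subseteq> \<Omega>"

end

theory Submission
  imports Defs
begin

text \<open>
  Young's inequality shows that \<open>\<Delta>'\<close> for the conjugate of \<open>\<Phi>\<close> reverses \<open>\<Delta>'\<close> for \<open>\<Phi>\<close>, so that
  \<open>\<Phi> (s t)\<close> and \<open>\<Phi> s * \<Phi> t\<close> are comparable. Then \<open>x \<mapsto> ln (\<Phi> (exp x))\<close> is monotone and additive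
  up to a bounded error, hence at bounded distance from a linear function, and \<open>\<Phi>\<close> is comparable
  to a power \<open>t\<^sup>p\<close>. Finiteness of the conjugate gives \<open>p > 1\<close>. If \<open>p \<ge> N\<close>, then
  \<open>H\<^sub>\<Phi>\<close> is infinite on \<open>(0, 1]\<close>, so \<open>\<Phi>\<^sub>N\<close> vanishes and \<open>B\<^sub>\<Phi>\<close> is no Young function; hence
  \<open>1 < p < N\<close>. Explicit estimates then bound \<open>B\<^sub>\<Phi>\<close> from above by a multiple of
  \<open>t powr (N / (N - p))\<close>, and its conjugate from below by a multiple of \<open>t powr (N / p)\<close>. What remains is
  Hoelder's inequality for \<open>|g| |u|\<^sup>p\<close> with exponents \<open>N / p\<close> and \<open>N / (N - p)\<close> followed by
  the classical Sobolev inequality, which is obtained from an inequality for integrals over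
  lines parallel to the axes.
\<close>

section \<open>Hoelder's inequality and integrals along coordinate lines\<close>

text \<open>Powers in \<open>[0, \<infinity>]\<close> with \<open>x\<^sup>0 = 1\<close> throughout, including \<open>x = 0\<close> and \<open>x = \<infinity>\<close> (unlike \<open>powr\<close>,
  where \<open>0 powr 0 = 0\<close>), so that factors with exponent 0 drop out of products.\<close>

definition epow :: "ennreal \<Rightarrow> real \<Rightarrow> ennreal" where
  "epow x a = (if a = 0 then 1 else if x = \<infinity> then \<infinity> else ennreal (enn2real x powr a))"

lemma epow_ennreal [simp]: "a > 0 \<Longrightarrow> 0 \<le> r \<Longrightarrow> epow (ennreal r) a = ennreal (r powr a)"
  by (simp add: epow_def)

lemma epow_0_left [simp]: "a > 0 \<Longrightarrow> epow 0 a = 0"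
  by (simp add: epow_def)

lemma epow_top [simp]: "a > 0 \<Longrightarrow> epow top a = top"
  by (simp add: epow_def)

lemma epow_0_right [simp]: "epow x 0 = 1"
  by (simp add: epow_def)

lemma epow_eq_0_iff: "a > 0 \<Longrightarrow> epow x a = 0 \<longleftrightarrow> x = 0"
  by (cases x) (auto simp: epow_def)

lemma epow_mono: "a \<ge> 0 \<Longrightarrow> x \<le> y \<Longrightarrow> epow x a \<le> epow y a"
  by (cases x; cases y) (auto simp: epow_def top_unique intro!: ennreal_leI powr_mono2)

lemma epow_add: "a \<ge> 0 \<Longrightarrow> b \<ge> 0 \<Longrightarrow> epow x (a + b) = epow x a * epow x b"
  by (cases x) (auto simp: epow_def powr_add ennreal_mult' ennreal_mult_top ennreal_top_mult)

lemma epow_power: "a \<ge> 0 \<Longrightarrow> epow x a ^ n = epow x (real n * a)"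
  by (induction n) (simp_all add: epow_add[symmetric] algebra_simps)

lemma epow_mult: "a \<ge> 0 \<Longrightarrow> epow (x * y) a = epow x a * epow y a"
proof (cases "a = 0")
  case False
  assume "a \<ge> 0"
  with False have a: "a > 0" by simp
  show ?thesis
  proof (cases "x = 0 \<or> y = 0")
    case True then show ?thesis using a by auto
  next
    case False
    then show ?thesis using a
      apply (cases x; cases y)
         apply (auto simp: ennreal_mult_top ennreal_top_mult epow_eq_0_iff ennreal_mult[symmetric] powr_mult)
      done
  qed
qed simp

lemma measurable_epow [measurable]:
  assumes [measurable]: "f \<in> borel_measurable M"
  shows "(\<lambda>x. epow (f x) a) \<in> borel_measurable M"
  unfolding epow_def by measurable

text \<open>Jensen's inequality for \<open>exp\<close> at the logarithms of the values. Infinite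
  values come first: there the right side is infinite because the weights are positive. After that a
  zero value makes the product vanish.\<close>

lemma weighted_arith_geom_epow:
  assumes I: "finite I" and w: "\<And>i. i \<in> I \<Longrightarrow> w i > 0" and w1: "(\<Sum>i\<in>I. w i) = 1"
  shows "(\<Prod>i\<in>I. epow (x i) (w i)) \<le> (\<Sum>i\<in>I. ennreal (w i) * x i)"
proof -
  consider (top) "\<exists>i\<in>I. x i = \<infinity>" | (zero) "\<exists>i\<in>I. x i = 0" 
    | (pos) "\<And>i. i \<in> I \<Longrightarrow> x i \<noteq> \<infinity> \<and> x i \<noteq> 0" by blast
  then show ?thesis
  proof cases
    case top
    then obtain i where "i \<in> I" "x i = \<infinity>" by blast
    then have "ennreal (w i) * x i = \<infinity>" using w[of i] by (simp add: ennreal_mult_top)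
    then have "(\<Sum>i\<in>I. ennreal (w i) * x i) = \<infinity>" using I \<open>i \<in> I\<close> by (simp add: sum.remove[of I i])
    then show ?thesis by simp
  next
    case zero
    have *: "(\<Prod>i\<in>I. epow (x i) (w i)) = 0" proof (intro prod_zero I)
      show "\<exists>i\<in>I. epow (x i) (w i) = 0" using zero w by (auto simp: epow_eq_0_iff)
    qed
    show ?thesis unfolding * by simp
  next
    case pos
    define r where "r i = enn2real (x i)" for i
    have r: "x i = ennreal (r i)" "r i > 0" if "i \<in> I" for i
      using pos[OF that] by (cases "x i"; simp add: r_def less_le)+
    have "I \<noteq> {}" using w1 by auto
    have "exp (\<Sum>i\<in>I. w i *\<^sub>R ln (r i)) \<le> (\<Sum>i\<in>I. w i * exp (ln (r i)))"
      using w by (intro convex_on_sum[OF I \<open>I \<noteq> {}\<close> exp_convex w1]) (auto intro: less_imp_le)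
    also have "\<dots> = (\<Sum>i\<in>I. w i * r i)" using r by (intro sum.cong) auto
    also have "exp (\<Sum>i\<in>I. w i *\<^sub>R ln (r i)) = (\<Prod>i\<in>I. r i powr w i)"
      unfolding exp_sum[OF I] 
    proof (intro prod.cong refl)
      fix i assume "i \<in> I"
      then show "exp (w i *\<^sub>R ln (r i)) = r i powr w i" using r(2)[of i] by (simp add: powr_def)
    qed
    finally have *: "(\<Prod>i\<in>I. r i powr w i) \<le> (\<Sum>i\<in>I. w i * r i)" .
    have "(\<Prod>i\<in>I. epow (x i) (w i)) = (\<Prod>i\<in>I. ennreal (r i powr w i))"
      using r w by (intro prod.cong) (auto intro!: epow_ennreal less_imp_le)
    also have "\<dots> = ennreal (\<Prod>i\<in>I. r i powr w i)" by (intro prod_ennreal) auto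
    also have "\<dots> \<le> ennreal (\<Sum>i\<in>I. w i * r i)" by (intro ennreal_leI *)
    also have "\<dots> = (\<Sum>i\<in>I. ennreal (w i * r i))" 
      using r w by (intro sum_ennreal[symmetric]) (auto intro!: mult_nonneg_nonneg less_imp_le)
    also have "\<dots> = (\<Sum>i\<in>I. ennreal (w i) * x i)"
      using r w by (intro sum.cong) (auto intro!: ennreal_mult less_imp_le)
    finally show ?thesis .
  qed
qed

text \<open>Divide each function by its integral and integrate the weighted arithmetic-geometric
  mean inequality pointwise; what is left is the sum of the weights, which is 1.\<close>

lemma nn_integral_Holder_pos:
  assumes I: "finite I" and w: "\<And>i. i \<in> I \<Longrightarrow> w i > 0" and w1: "(\<Sum>i\<in>I. w i) = 1"
    and f [measurable]: "\<And>i. i \<in> I \<Longrightarrow> f i \<in> borel_measurable M"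
  shows "(\<integral>\<^sup>+ x. (\<Prod>i\<in>I. epow (f i x) (w i)) \<partial>M) \<le> (\<Prod>i\<in>I. epow (\<integral>\<^sup>+ x. f i x \<partial>M) (w i))"
proof -
  define a where "a i = (\<integral>\<^sup>+ x. f i x \<partial>M)" for i
  \<comment> \<open>Zero integrals come before infinite ones: a product with a zero factor is 0 even
    if another factor is infinite, so there the left side must be shown to vanish.\<close>
  consider (zero) "\<exists>i\<in>I. a i = 0" | (top) "\<forall>i\<in>I. a i \<noteq> 0" "\<exists>i\<in>I. a i = \<infinity>"
    | (pos) "\<And>i. i \<in> I \<Longrightarrow> a i \<noteq> \<infinity> \<and> a i \<noteq> 0" by blast
  then show ?thesis
  proof cases
    case zero
    then obtain i where i: "i \<in> I" "a i = 0" by blast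
    then have "AE x in M. f i x = 0" using f[of i] by (simp add: a_def nn_integral_0_iff_AE)
    then have "AE x in M. (\<Prod>i\<in>I. epow (f i x) (w i)) = 0"
      using i I w by (auto simp: epow_eq_0_iff intro: bexI[of _ i] elim!: eventually_mono)
    then have "(\<integral>\<^sup>+ x. (\<Prod>i\<in>I. epow (f i x) (w i)) \<partial>M) = (\<integral>\<^sup>+ x. 0 \<partial>M)"
      by (intro nn_integral_cong_AE)
    then show ?thesis by simp
  next
    case top
    then obtain i where i: "i \<in> I" "a i = \<infinity>" by blast
    have "(\<Prod>j\<in>I. epow (a j) (w j)) = \<infinity>"
      using i I w top by (subst prod.remove[of _ i]) (auto simp: epow_eq_0_iff ennreal_top_mult)
    then show ?thesis unfolding a_def by simp
  next
    case pos
    have le: "(\<Prod>i\<in>I. epow (f i x) (w i)) \<le> (\<Prod>i\<in>I. epow (a i) (w i)) * (\<Sum>i\<in>I. ennreal (w i) * (f i x / a i))" for x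
    proof -
      have "(\<Prod>i\<in>I. epow (f i x) (w i)) = (\<Prod>i\<in>I. epow (a i) (w i) * epow (f i x / a i) (w i))"
      proof (intro prod.cong refl)
        fix i assume i: "i \<in> I"
        have "f i x = a i * (f i x / a i)"
          using pos[OF i] by (simp add: ennreal_times_divide mult.commute[of "a i"] ennreal_mult_divide_eq)
        then show "epow (f i x) (w i) = epow (a i) (w i) * epow (f i x / a i) (w i)"
          using w[OF i] epow_mult by (metis less_imp_le)
      qed
      also have "\<dots> \<le> (\<Prod>i\<in>I. epow (a i) (w i)) * (\<Sum>i\<in>I. ennreal (w i) * (f i x / a i))"
        unfolding prod.distrib by (intro mult_left_mono weighted_arith_geom_epow[OF I w w1]) auto
      finally show ?thesis .
    qed
    have "(\<integral>\<^sup>+ x. (\<Prod>i\<in>I. epow (f i x) (w i)) \<partial>M)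
       \<le> (\<integral>\<^sup>+ x. (\<Prod>i\<in>I. epow (a i) (w i)) * (\<Sum>i\<in>I. ennreal (w i) * (f i x / a i)) \<partial>M)"
      by (intro nn_integral_mono le)
    also have "\<dots> = (\<Prod>i\<in>I. epow (a i) (w i)) * (\<Sum>i\<in>I. ennreal (w i) * (a i / a i))"
      by (simp add: nn_integral_cmult nn_integral_sum nn_integral_divide a_def)
    also have "(\<Sum>i\<in>I. ennreal (w i) * (a i / a i)) = (\<Sum>i\<in>I. ennreal (w i))"
      using pos by (intro sum.cong refl) (simp add: ennreal_divide_self top.not_eq_extremum)
    also have "\<dots> = 1" using w1 w by (subst sum_ennreal) (auto intro: less_imp_le)
    finally show ?thesis unfolding a_def by simp
  qed
qed

text \<open>Weight 0 occurs below: for \<open>p = 1 / (n - 1)\<close> in \<open>n\<close> dimensions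
  the extra power of \<open>f\<close> has exponent 0. Such factors equal 1 and drop out.\<close>

lemma nn_integral_Holder:
  assumes I: "finite I" and w: "\<And>i. i \<in> I \<Longrightarrow> w i \<ge> 0" and w1: "(\<Sum>i\<in>I. w i) = 1"
    and f: "\<And>i. i \<in> I \<Longrightarrow> f i \<in> borel_measurable M"
  shows "(\<integral>\<^sup>+ x. (\<Prod>i\<in>I. epow (f i x) (w i)) \<partial>M) \<le> (\<Prod>i\<in>I. epow (\<integral>\<^sup>+ x. f i x \<partial>M) (w i))"
proof -
  define J where "J = {i \<in> I. w i > 0}"
  have J: "J \<subseteq> I" and zero: "\<And>i. i \<in> I - J \<Longrightarrow> w i = 0" using w by (force simp: J_def)+
  have eq: "(\<Prod>i\<in>I. epow (h i) (w i)) = (\<Prod>i\<in>J. epow (h i) (w i))" for h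
    using I J zero by (intro prod.mono_neutral_right) auto
  have "(\<Sum>i\<in>J. w i) = 1"
    using w1 I J zero by (metis sum.mono_neutral_right)
  then show ?thesis unfolding eq
    using I J f by (intro nn_integral_Holder_pos) (auto simp: J_def)
qed

lemma nn_integral_Holder2:
  assumes "a \<ge> 0" "b \<ge> 0" "a + b = 1" "f \<in> borel_measurable M" "g \<in> borel_measurable M"
  shows "(\<integral>\<^sup>+ x. epow (f x) a * epow (g x) b \<partial>M)
    \<le> epow (\<integral>\<^sup>+ x. f x \<partial>M) a * epow (\<integral>\<^sup>+ x. g x \<partial>M) b"
proof -
  have "(\<integral>\<^sup>+ x. (\<Prod>i\<in>{True, False}. epow ((if i then f else g) x) (if i then a else b)) \<partial>M)
    \<le> (\<Prod>i\<in>{True, False}. epow (\<integral>\<^sup>+ x. (if i then f else g) x \<partial>M) (if i then a else b))"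
    using assms by (intro nn_integral_Holder) auto
  then show ?thesis by simp
qed

text \<open>Integrating out one coordinate \<open>i\<close> with Hoelder's inequality reduces the claim for \<open>f\<close> to the
  claim for the marginal of \<open>f\<close> over \<open>i\<close> on the remaining coordinates; the extra power of \<open>f\<close> on
  the left makes this induction close.\<close>

lemma grid_lines_inequality:
  fixes I :: "'i set" and p :: real
  assumes "finite I" "p \<ge> 0" "(real (card I) - 1) * p \<le> 1"
    "f \<in> borel_measurable (Pi\<^sub>M I (\<lambda>_. lborel :: real measure))"
  shows "(\<integral>\<^sup>+ x. epow (f x) (1 - (real (card I) - 1) * p) *
            (\<Prod>i\<in>I. epow (\<integral>\<^sup>+ t. f (x(i := t)) \<partial>lborel) p) \<partial>Pi\<^sub>M I (\<lambda>_. lborel))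
      \<le> epow (\<integral>\<^sup>+ x. f x \<partial>Pi\<^sub>M I (\<lambda>_. lborel)) (1 + p)"
  using assms
proof (induction I arbitrary: f rule: finite_induct)
  \<comment> \<open>With no coordinates the exponent of \<open>f\<close> is \<open>1 + p\<close>,
    and both sides are that power of the value of \<open>f\<close> at the single point.\<close>
  case empty
  interpret product_sigma_finite "\<lambda>_. lborel :: real measure" by standard
  show ?case by (simp add: nn_integral_empty)
next
  case (insert i I)
  interpret product_sigma_finite "\<lambda>_. lborel :: real measure" by standard
  note [measurable] = \<open>f \<in> _\<close>
  let ?P = "Pi\<^sub>M I (\<lambda>_. lborel :: real measure)"
  have card: "real (card (insert i I)) - 1 = real (card I)" using insert by simp
  define F where "F x = (\<integral>\<^sup>+ t. f (x(i := t)) \<partial>lborel)" for x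
  have upd [measurable]: "(\<lambda>(x, y). x(i := y)) \<in> measurable (?P \<Otimes>\<^sub>M lborel) (Pi\<^sub>M (insert i I) (\<lambda>_. lborel))"
    by measurable
  have F [measurable]: "F \<in> borel_measurable ?P" unfolding F_def by measurable
  have upd1: "(\<lambda>y. x(i := y)) \<in> measurable lborel (Pi\<^sub>M (insert i I) (\<lambda>_. lborel))" if "x \<in> space ?P" for x
    using that by (intro measurable_fun_upd[where J=I]) auto
  have updj: "(\<lambda>q. x(j := snd q, i := fst q)) \<in> measurable (lborel \<Otimes>\<^sub>M lborel) (Pi\<^sub>M (insert i I) (\<lambda>_. lborel))" 
    if x: "x \<in> space ?P" and j: "j \<in> I" for x j
    using x j by (intro measurable_fun_upd[where J=I]) (auto intro!: measurable_fun_upd[where J=I])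
  \<comment> \<open>For fixed \<open>x\<close> the factor with \<open>F x\<close> is constant in
    \<open>y\<close> and leaves the integral. The exponents of the other factors add up to 1, so
    Hoelder's inequality in \<open>y\<close> applies, and Fubini turns the integrated line integrals
    of \<open>f\<close> into line integrals of \<open>F\<close>.\<close>
  have ineq: "(\<integral>\<^sup>+ y. epow (f (x(i := y))) (1 - real (card I) * p) * epow (F x) p
        * (\<Prod>j\<in>I. epow (\<integral>\<^sup>+ t. f (x(i := y, j := t)) \<partial>lborel) p) \<partial>lborel)
     \<le> epow (F x) (1 - (real (card I) - 1) * p) * (\<Prod>j\<in>I. epow (\<integral>\<^sup>+ t. F (x(j := t)) \<partial>lborel) p)" 
    (is "?L \<le> ?R") if x: "x \<in> space ?P" for x
  proof -
    define w where "w j = (if j = i then 1 - real (card I) * p else p)" for j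
    define h where "h j = (if j = i then (\<lambda>y. f (x(i := y))) else (\<lambda>y. \<integral>\<^sup>+ t. f (x(j := t, i := y)) \<partial>lborel))" for j
    have meas: "h j \<in> borel_measurable lborel" if "j \<in> insert i I" for j
    proof (cases "j = i")
      case True
      have "(\<lambda>y. f (x(i := y))) \<in> borel_measurable lborel"
        by (rule measurable_compose[OF upd1[OF x] insert.prems(3)])
      then show ?thesis using True by (simp add: h_def)
    next
      case False
      with that have "(\<lambda>q. f (x(j := snd q, i := fst q))) \<in> borel_measurable (lborel \<Otimes>\<^sub>M lborel)"
        by (intro measurable_compose[OF updj[OF x] insert.prems(3)]) auto
      then have "(\<lambda>y. \<integral>\<^sup>+ t. f (x(j := t, i := y)) \<partial>lborel) \<in> borel_measurable lborel"
        by (intro lborel.borel_measurable_nn_integral) (simp add: split_beta)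
      then show ?thesis using False by (simp add: h_def)
    qed
    have fub: "(\<integral>\<^sup>+ y. h j y \<partial>lborel) = (\<integral>\<^sup>+ t. F (x(j := t)) \<partial>lborel)" if "j \<in> I" for j
    proof -
      have ji: "j \<noteq> i" using that insert by auto
      have "(\<lambda>q. f (x(j := snd q, i := fst q))) \<in> borel_measurable (lborel \<Otimes>\<^sub>M lborel)"
        by (rule measurable_compose[OF updj[OF x that] insert.prems(3)])
      then have "(\<integral>\<^sup>+ y. \<integral>\<^sup>+ t. f (x(j := t, i := y)) \<partial>lborel \<partial>lborel) = (\<integral>\<^sup>+ t. \<integral>\<^sup>+ y. f (x(j := t, i := y)) \<partial>lborel \<partial>lborel)"
        by (intro lborel_pair.Fubini'[symmetric]) (simp add: split_beta)
      then show ?thesis using ji by (simp add: h_def F_def)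
    qed
    have "?L = (\<integral>\<^sup>+ y. epow (F x) p * (\<Prod>j\<in>insert i I. epow (h j y) (w j)) \<partial>lborel)"
    proof (intro nn_integral_cong)
      fix y
      have "(\<Prod>j\<in>insert i I. epow (h j y) (w j)) = epow (f (x(i := y))) (1 - real (card I) * p) *
           (\<Prod>j\<in>I. epow (h j y) (w j))"
        using insert by (simp add: h_def w_def)
      also have "(\<Prod>j\<in>I. epow (h j y) (w j)) = (\<Prod>j\<in>I. epow (\<integral>\<^sup>+ t. f (x(i := y, j := t)) \<partial>lborel) p)"
        using insert by (intro prod.cong) (auto simp: h_def w_def fun_upd_twist)
      finally show "epow (f (x(i := y))) (1 - real (card I) * p) * epow (F x) p
        * (\<Prod>j\<in>I. epow (\<integral>\<^sup>+ t. f (x(i := y, j := t)) \<partial>lborel) p) = epow (F x) p * (\<Prod>j\<in>insert i I. epow (h j y) (w j))"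
        by (simp only: ac_simps)
    qed
    also have "\<dots> = epow (F x) p * (\<integral>\<^sup>+ y. (\<Prod>j\<in>insert i I. epow (h j y) (w j)) \<partial>lborel)"
      by (intro nn_integral_cmult borel_measurable_prod_ennreal measurable_epow meas)
    also have "\<dots> \<le> epow (F x) p * (\<Prod>j\<in>insert i I. epow (\<integral>\<^sup>+ y. h j y \<partial>lborel) (w j))"
    proof (intro mult_left_mono nn_integral_Holder meas)
      have "(\<Sum>j\<in>I. w j) = (\<Sum>j\<in>I. p)" using insert by (intro sum.cong) (auto simp: w_def)
      then show "sum w (insert i I) = 1" using insert by (simp add: w_def)
    qed (use insert card in \<open>auto simp: w_def\<close>)
    also have "(\<Prod>j\<in>insert i I. epow (\<integral>\<^sup>+ y. h j y \<partial>lborel) (w j)) =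
       epow (F x) (1 - real (card I) * p) * (\<Prod>j\<in>I. epow (\<integral>\<^sup>+ y. h j y \<partial>lborel) (w j))"
      using insert by (simp add: w_def h_def F_def)
    also have "(\<Prod>j\<in>I. epow (\<integral>\<^sup>+ y. h j y \<partial>lborel) (w j)) = (\<Prod>j\<in>I. epow (\<integral>\<^sup>+ t. F (x(j := t)) \<partial>lborel) p)"
      using fub insert by (intro prod.cong) (auto simp: w_def)
    also have "epow (F x) p * (epow (F x) (1 - real (card I) * p) * (\<Prod>j\<in>I. epow (\<integral>\<^sup>+ t. F (x(j := t)) \<partial>lborel) p)) = ?R"
    proof -
      \<comment> \<open>The factor pulled out and the factor produced by Hoelder's inequality
        combine to the exponent in the induction hypothesis.\<close>
      have "1 - (real (card I) - 1) * p = p + (1 - real (card I) * p)" by (simp add: algebra_simps)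
      then show ?thesis using insert.prems(1,2) card by (simp only: epow_add mult.assoc diff_ge_0_iff_ge)
    qed
    finally show ?thesis .
  qed
  have measI: "(\<lambda>x. \<integral>\<^sup>+ t. f (x(j := t)) \<partial>lborel) \<in> borel_measurable (Pi\<^sub>M (insert i I) (\<lambda>_. lborel))" 
    if "j \<in> insert i I" for j
  proof -
    have "(\<lambda>q. (fst q)(j := snd q)) \<in> measurable (Pi\<^sub>M (insert i I) (\<lambda>_. lborel) \<Otimes>\<^sub>M lborel) (Pi\<^sub>M (insert i I) (\<lambda>_. lborel :: real measure))"
      using that by (intro measurable_fun_upd[where J="insert i I"]) auto
    then have "(\<lambda>q. f ((fst q)(j := snd q))) \<in> borel_measurable (Pi\<^sub>M (insert i I) (\<lambda>_. lborel) \<Otimes>\<^sub>M lborel)"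
      by (rule measurable_compose[OF _ insert.prems(3)])
    then show ?thesis
      by (intro lborel.borel_measurable_nn_integral) (simp add: split_beta)
  qed
  define K where "K x = epow (f x) (1 - real (card I) * p) *
      (\<Prod>j\<in>insert i I. epow (\<integral>\<^sup>+ t. f (x(j := t)) \<partial>lborel) p)" for x
  have measK: "K \<in> borel_measurable (Pi\<^sub>M (insert i I) (\<lambda>_. lborel))"
    unfolding K_def
    by (intro borel_measurable_times_ennreal borel_measurable_prod_ennreal measurable_epow insert.prems(3) measI)
  \<comment> \<open>In direction \<open>i\<close> itself the second update overwrites
    \<open>y\<close>, so that line integral is \<open>F x\<close>.\<close>
  have K: "K (x(i := y)) = epow (f (x(i := y))) (1 - real (card I) * p) * epow (F x) p
        * (\<Prod>j\<in>I. epow (\<integral>\<^sup>+ t. f (x(i := y, j := t)) \<partial>lborel) p)" for x y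
    unfolding K_def F_def prod.insert[OF insert.hyps(1,2)] fun_upd_upd by (simp only: mult.assoc)
  have "(\<integral>\<^sup>+ x. K x \<partial>Pi\<^sub>M (insert i I) (\<lambda>_. lborel)) = (\<integral>\<^sup>+ x. \<integral>\<^sup>+ y. K (x(i := y)) \<partial>lborel \<partial>?P)"
    by (rule product_nn_integral_insert[OF insert.hyps(1,2) measK])
  also have "\<dots> \<le> (\<integral>\<^sup>+ x. epow (F x) (1 - (real (card I) - 1) * p) * (\<Prod>j\<in>I. epow (\<integral>\<^sup>+ t. F (x(j := t)) \<partial>lborel) p) \<partial>?P)"
    unfolding K by (intro nn_integral_mono ineq)
  also have "\<dots> \<le> epow (\<integral>\<^sup>+ x. F x \<partial>?P) (1 + p)"
  proof (rule insert.IH)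
    show "(real (card I) - 1) * p \<le> 1" using insert.prems card by (simp add: algebra_simps)
  qed (use insert.prems F in auto)
  also have "(\<integral>\<^sup>+ x. F x \<partial>?P) = (\<integral>\<^sup>+ x. f x \<partial>Pi\<^sub>M (insert i I) (\<lambda>_. lborel))"
    unfolding F_def by (rule product_nn_integral_insert[OF insert.hyps(1,2) insert.prems(3), symmetric])
  finally show ?case unfolding K_def card .
qed

section \<open>The Sobolev inequality\<close>

text \<open>The power \<open>N'\<close> of \<open>w\<close> is a product of \<open>N\<close> factors
  with exponent \<open>1 / (N - 1)\<close>, one for each axis, and each is bounded by its own line
  integral. For \<open>p = 1 / (N - 1)\<close> the extra power in
  \<open>grid_lines_inequality\<close> disappears and \<open>1 + p = N'\<close>.\<close>

lemma Gagliardo_lines: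
  fixes w G :: "'a::euclidean_space \<Rightarrow> ennreal"
  assumes dim: "DIM('a) \<ge> 2"
    and w [measurable]: "w \<in> borel_measurable borel" and G [measurable]: "G \<in> borel_measurable borel"
    and line: "\<And>x b. b \<in> Basis \<Longrightarrow> w x \<le> (\<integral>\<^sup>+ t. G (x + (t - x \<bullet> b) *\<^sub>R b) \<partial>lborel)"
  shows "(\<integral>\<^sup>+ x. epow (w x) (conj_exp DIM('a)) \<partial>lborel) \<le> epow (\<integral>\<^sup>+ x. G x \<partial>lborel) (conj_exp DIM('a))"
proof -
  define p where "p = 1 / (real DIM('a) - 1)"
  have p: "p \<ge> 0" "(real DIM('a) - 1) * p = 1" and N': "conj_exp DIM('a) = 1 + p" "conj_exp DIM('a) = real DIM('a) * p"
    using dim by (auto simp: p_def conj_exp_def field_simps)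
  let ?P = "Pi\<^sub>M Basis (\<lambda>_. lborel :: real measure)"
  \<comment> \<open>\<open>S\<close> assembles a point from its coordinates and carries the product
    measure to \<open>lborel\<close>; updating one coordinate is a shift along that axis.\<close>
  define S where "S f = (\<Sum>b\<in>Basis. f b *\<^sub>R b)" for f :: "'a \<Rightarrow> real"
  have S [measurable]: "S \<in> measurable ?P borel" unfolding S_def by measurable
  have lb: "(\<integral>\<^sup>+ x. h x \<partial>lborel) = (\<integral>\<^sup>+ f. h (S f) \<partial>?P)" if [measurable]: "h \<in> borel_measurable borel" for h
    by (subst lborel_eq) (simp add: nn_integral_distr S_def[symmetric])
  have upd: "S (f(b := t)) = S f + (t - S f \<bullet> b) *\<^sub>R b" if b: "b \<in> Basis" for f b t
  proof -
    have "S f \<bullet> b = f b" using b by (simp add: S_def inner_sum_left inner_Basis if_distrib sum.delta cong: if_cong)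
    moreover have "S (f(b := t)) = t *\<^sub>R b + (\<Sum>c\<in>Basis-{b}. f c *\<^sub>R c)"
      unfolding S_def using b by (subst sum.remove[of _ b]) (auto intro!: sum.cong)
    moreover have "S f = f b *\<^sub>R b + (\<Sum>c\<in>Basis-{b}. f c *\<^sub>R c)"
      unfolding S_def using b by (subst sum.remove[of _ b]) auto
    ultimately show ?thesis by (simp add: algebra_simps)
  qed
  have "(\<integral>\<^sup>+ x. epow (w x) (conj_exp DIM('a)) \<partial>lborel) = (\<integral>\<^sup>+ f. epow (w (S f)) (conj_exp DIM('a)) \<partial>?P)"
    by (rule lb) measurable
  also have "\<dots> \<le> (\<integral>\<^sup>+ f. epow (G (S f)) (1 - (real DIM('a) - 1) * p) *
      (\<Prod>b\<in>Basis. epow (\<integral>\<^sup>+ t. G (S (f(b := t))) \<partial>lborel) p) \<partial>?P)"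
  proof (intro nn_integral_mono)
    fix f
    have "epow (w (S f)) (conj_exp DIM('a)) = (\<Prod>b\<in>(Basis::'a set). epow (w (S f)) p)"
      using p by (simp add: N'(2) epow_power)
    also have "\<dots> \<le> (\<Prod>b\<in>Basis. epow (\<integral>\<^sup>+ t. G (S (f(b := t))) \<partial>lborel) p)"
      using line p by (intro prod_mono_ennreal epow_mono) (auto simp: upd)
    finally show "epow (w (S f)) (conj_exp DIM('a)) \<le> epow (G (S f)) (1 - (real DIM('a) - 1) * p) *
      (\<Prod>b\<in>Basis. epow (\<integral>\<^sup>+ t. G (S (f(b := t))) \<partial>lborel) p)"
      using p by simp
  qed
  also have "\<dots> \<le> epow (\<integral>\<^sup>+ f. G (S f) \<partial>?P) (1 + p)"
    using p by (intro grid_lines_inequality) auto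
  also have "(\<integral>\<^sup>+ f. G (S f) \<partial>?P) = (\<integral>\<^sup>+ x. G x \<partial>lborel)"
    by (rule lb[symmetric]) measurable
  finally show ?thesis by (simp add: N')
qed

section \<open>From line integrals to the Sobolev inequality for 1 < p < N\<close>

lemma DERIV_abs_powr:
  fixes s :: real
  assumes "\<gamma> > 1"
  shows "((\<lambda>s. \<bar>s\<bar> powr \<gamma>) has_real_derivative (\<gamma> * \<bar>s\<bar> powr (\<gamma> - 1) * sgn s)) (at s)"
proof -
  consider "s > 0" | "s < 0" | "s = 0" by linarith
  then show ?thesis
  proof cases
    case 1
    have "((\<lambda>s. s powr \<gamma>) has_real_derivative (\<gamma> * \<bar>s\<bar> powr (\<gamma> - 1) * sgn s)) (at s)"
      using 1 by (auto intro!: derivative_eq_intros)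
    then show ?thesis
      by (rule has_field_derivative_transform_within_open[of _ _ _ "{0<..}"]) (use 1 in auto)
  next
    case 2
    have "((\<lambda>s. (-s) powr \<gamma>) has_real_derivative (\<gamma> * \<bar>s\<bar> powr (\<gamma> - 1) * sgn s)) (at s)"
      using 2 by (auto intro!: derivative_eq_intros)
    then show ?thesis
      by (rule has_field_derivative_transform_within_open[of _ _ _ "{..<0}"]) (use 2 in auto)
  next
    \<comment> \<open>At 0 the difference quotient is bounded by
      \<open>\<bar>h\<bar> powr (\<gamma> - 1)\<close>, which tends to 0 because \<gamma> >
      1.\<close>
    case 3
    have "((\<lambda>h::real. \<bar>h\<bar> powr (\<gamma> - 1)) \<longlongrightarrow> 0) (at 0)"
    proof (rule tendsto_eq_rhs)
      show "((\<lambda>h::real. \<bar>h\<bar> powr (\<gamma> - 1)) \<longlongrightarrow> \<bar>0\<bar> powr (\<gamma> - 1)) (at 0)"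
        using assms by (intro tendsto_powr' tendsto_intros) auto
    qed (use assms in auto)
    then have "((\<lambda>h::real. (\<bar>0 + h\<bar> powr \<gamma> - \<bar>0\<bar> powr \<gamma>) / h) \<longlongrightarrow> 0) (at 0)"
    proof (rule Lim_null_comparison[rotated])
      show "\<forall>\<^sub>F h in at 0. norm ((\<bar>0 + h\<bar> powr \<gamma> - \<bar>0\<bar> powr \<gamma>) / h) \<le> \<bar>h\<bar> powr (\<gamma> - 1)"
        using assms by (auto simp: eventually_at_filter powr_diff abs_divide intro!: always_eventually)
    qed
    then show ?thesis using 3 by (simp add: DERIV_def)
  qed
qed

text \<open>The fundamental theorem of calculus, started at a point left of \<open>x\<close> where
  \<open>u\<close> vanishes.\<close>

lemma abs_powr_le_line_integral:
  fixes u :: "real \<Rightarrow> real" and u' :: "real \<Rightarrow> real"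
  assumes \<gamma>: "\<gamma> > 1" and deriv: "\<And>t. (u has_real_derivative u' t) (at t)"
    and cont: "continuous_on UNIV u'" and bdd: "bounded {t. u t \<noteq> 0}"
  shows "ennreal (\<bar>u x\<bar> powr \<gamma>) \<le> (\<integral>\<^sup>+ t. ennreal (\<gamma> * \<bar>u t\<bar> powr (\<gamma> - 1) * \<bar>u' t\<bar>) \<partial>lborel)"
proof -
  obtain R where R: "\<And>t. u t \<noteq> 0 \<Longrightarrow> \<bar>t\<bar> \<le> R" using bdd by (auto simp: bounded_iff)
  \<comment> \<open>\<open>R\<close> can be negative if \<open>u\<close> vanishes identically, hence
    the absolute value; in every case \<open>a\<close> lies left of \<open>x\<close> and outside the
    support.\<close>
  define a where "a = min x (- \<bar>R\<bar> - 1)"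
  have ax: "a \<le> x" and "\<not> \<bar>a\<bar> \<le> R" by (auto simp: a_def abs_if min_def)
  with R[of a] have ua: "u a = 0" by blast
  have cu: "continuous_on UNIV u" 
    using deriv by (meson DERIV_continuous continuous_at_imp_continuous_on)
  let ?D = "\<lambda>t. \<gamma> * \<bar>u t\<bar> powr (\<gamma> - 1) * sgn (u t) * u' t"
  let ?G = "\<lambda>t. \<gamma> * \<bar>u t\<bar> powr (\<gamma> - 1) * \<bar>u' t\<bar>"
  have cG: "continuous_on UNIV ?G"
    using \<gamma> by (intro continuous_intros continuous_on_powr' cu cont) auto
  have "((\<lambda>t. \<bar>u t\<bar> powr \<gamma>) has_real_derivative ?D t) (at t)" for t
    using DERIV_chain2[OF DERIV_abs_powr[OF \<gamma>] deriv] by simp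
  then have D: "(?D has_integral \<bar>u x\<bar> powr \<gamma> - \<bar>u a\<bar> powr \<gamma>) {a..x}"
    by (intro fundamental_theorem_of_calculus ax) 
       (auto simp: has_real_derivative_iff_has_vector_derivative[symmetric] intro: has_field_derivative_at_within)
  have Gi: "?G integrable_on {a..x}"
    by (intro integrable_continuous_interval continuous_on_subset[OF cG]) auto
  have "\<bar>u x\<bar> powr \<gamma> \<le> integral {a..x} ?G"
    using has_integral_le[OF D integrable_integral[OF Gi]] ua \<gamma>
    by (auto simp: sgn_if abs_if mult_left_mono split: if_splits)
  then have "ennreal (\<bar>u x\<bar> powr \<gamma>) \<le> ennreal (integral {a..x} ?G)" by (rule ennreal_leI)
  also have "\<dots> = (\<integral>\<^sup>+ t. ennreal (?G t) * indicator {a..x} t \<partial>lborel)"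
    using \<gamma> by (intro nn_integral_has_integral_lebesgue'[symmetric] integrable_integral[OF Gi]) auto
  also have "\<dots> \<le> (\<integral>\<^sup>+ t. ennreal (?G t) \<partial>lborel)"
    by (intro nn_integral_mono) (auto simp: indicator_def)
  finally show ?thesis .
qed

text \<open>Applies the case \<open>p = 1\<close> to \<open>|u| powr \<gamma>\<close>, where \<open>\<gamma>\<close> is chosen so that the power of \<open>|u|\<close> that
  Hoelder's inequality splits off the gradient term is again \<open>|u| powr ps\<close>.\<close>

lemma Gagliardo_Nirenberg_Sobolev:
  fixes u :: "'a::euclidean_space \<Rightarrow> real" and Du :: "'a \<Rightarrow> 'a" and p :: real
  assumes dim: "DIM('a) \<ge> 2" and p: "1 < p" "p < DIM('a)"
    and u: "C1c_with_grad \<Omega> u Du"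
  defines "ps \<equiv> DIM('a) * p / (DIM('a) - p)"
  shows "epow (\<integral>\<^sup>+ x. ennreal (\<bar>u x\<bar> powr ps) \<partial>lborel) (p / ps)
    \<le> ennreal ((p * (DIM('a) - 1) / (DIM('a) - p)) powr p) * (\<integral>\<^sup>+ x. ennreal (norm (Du x) powr p) \<partial>lborel)"
proof -
  define N where "N = real DIM('a)"
  define \<gamma> where "\<gamma> = p * (N - 1) / (N - p)"
  define A where "A = (\<integral>\<^sup>+ x. ennreal (\<bar>u x\<bar> powr ps) \<partial>lborel)"
  define D where "D = (\<integral>\<^sup>+ x. ennreal (norm (Du x) powr p) \<partial>lborel)"
  have N: "N \<ge> 2" "1 < p" "p < N" using dim p by (auto simp: N_def)
  have ps: "ps = N * p / (N - p)" by (simp add: ps_def N_def)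
  have \<gamma>1: "\<gamma> > 1" using N by (simp add: \<gamma>_def field_simps)
  have der: "\<And>x. (u has_derivative (\<lambda>h. Du x \<bullet> h)) (at x)" and cD: "continuous_on UNIV Du"
    and comp: "compact (closure {x. u x \<noteq> 0})" using u unfolding C1c_with_grad_def by blast+
  have cu: "continuous_on UNIV u"
    using der by (meson continuous_at_imp_continuous_on has_derivative_continuous)
  have [measurable]: "u \<in> borel_measurable borel" "Du \<in> borel_measurable borel"
    using cu cD by (auto intro: borel_measurable_continuous_onI)
  define G where "G x = \<gamma> * \<bar>u x\<bar> powr (\<gamma> - 1) * norm (Du x)" for x
  have line: "ennreal (\<bar>u x\<bar> powr \<gamma>) \<le> (\<integral>\<^sup>+ t. ennreal (G (x + (t - x \<bullet> b) *\<^sub>R b)) \<partial>lborel)" 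
    if b: "b \<in> Basis" for x b
  proof -
    define L where "L t = x + (t - x \<bullet> b) *\<^sub>R b" for t
    have "ennreal (\<bar>u (L (x \<bullet> b))\<bar> powr \<gamma>) \<le> (\<integral>\<^sup>+ t. ennreal (\<gamma> * \<bar>u (L t)\<bar> powr (\<gamma> - 1) * \<bar>Du (L t) \<bullet> b\<bar>) \<partial>lborel)"
    proof (rule abs_powr_le_line_integral[OF \<gamma>1])
      fix t
      have "(L has_derivative (\<lambda>h. h *\<^sub>R b)) (at t)" 
        unfolding L_def by (auto intro!: derivative_eq_intros)
      from has_derivative_compose[OF this der]
      have "((\<lambda>t. u (L t)) has_derivative (\<lambda>h. Du (L t) \<bullet> (h *\<^sub>R b))) (at t)" .
      also have "(\<lambda>h. Du (L t) \<bullet> (h *\<^sub>R b)) = (*) (Du (L t) \<bullet> b)" by (simp add: fun_eq_iff)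
      finally show "((\<lambda>t. u (L t)) has_real_derivative Du (L t) \<bullet> b) (at t)"
        by (simp only: has_field_derivative_def)
    next
      show "continuous_on UNIV (\<lambda>t. Du (L t) \<bullet> b)"
        unfolding L_def by (intro continuous_intros continuous_on_compose2[OF cD]) auto
    next
      obtain R where R: "\<And>y. u y \<noteq> 0 \<Longrightarrow> norm y \<le> R" 
        using bounded_subset[OF compact_imp_bounded[OF comp] closure_subset] by (auto simp: bounded_iff)
      \<comment> \<open>The parameter of the line is the coordinate in direction \<open>b\<close>,
        so a norm bound on the support bounds the parameter.\<close>
      have "L t \<bullet> b = t" for t using b by (simp add: L_def inner_add_left)
      then have "\<bar>t\<bar> \<le> R" if "u (L t) \<noteq> 0" for t
        using R[OF that] Basis_le_norm[OF b, of "L t"] by simp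
      then show "bounded {t. u (L t) \<noteq> 0}" by (auto simp: bounded_iff)
    qed
    also have "\<dots> \<le> (\<integral>\<^sup>+ t. ennreal (G (L t)) \<partial>lborel)"
      unfolding G_def using \<gamma>1 b Cauchy_Schwarz_ineq2[of _ b]
      by (intro nn_integral_mono ennreal_leI mult_left_mono) auto
    finally show ?thesis by (simp add: L_def)
  qed
  \<comment> \<open>These identities fix \<gamma>: the first turns the left side of the inequality
    for exponent 1 into \<open>A\<close>, the second makes Hoelder's inequality reproduce
    \<open>A\<close> on the right.\<close>
  have exps: "\<gamma> * conj_exp DIM('a) = ps" "(\<gamma> - 1) * (p / (p - 1)) = ps" "conj_exp DIM('a) > 0" "ps > 0"
    using N by (auto simp: \<gamma>_def ps conj_exp_def N_def[symmetric] divide_simps) (auto simp: algebra_simps)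
  have "A = (\<integral>\<^sup>+ x. epow (ennreal (\<bar>u x\<bar> powr \<gamma>)) (conj_exp DIM('a)) \<partial>lborel)"
    unfolding A_def using exps by (simp add: powr_powr)
  also have "\<dots> \<le> epow (\<integral>\<^sup>+ x. ennreal (G x) \<partial>lborel) (conj_exp DIM('a))"
    using line by (intro Gagliardo_lines dim) (auto simp: G_def)
  also have "(\<integral>\<^sup>+ x. ennreal (G x) \<partial>lborel) = (\<integral>\<^sup>+ x. ennreal \<gamma> * (epow (ennreal (\<bar>u x\<bar> powr ps)) ((p - 1) / p) * epow (ennreal (norm (Du x) powr p)) (1 / p)) \<partial>lborel)"
  proof (intro nn_integral_cong)
    fix x
    have "ps * ((p - 1) / p) = \<gamma> - 1" using exps(2) N by (simp add: field_simps)
    then have "epow (ennreal (\<bar>u x\<bar> powr ps)) ((p - 1) / p) = ennreal (\<bar>u x\<bar> powr (\<gamma> - 1))"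
      using N by (simp add: powr_powr)
    moreover have "epow (ennreal (norm (Du x) powr p)) (1 / p) = ennreal (norm (Du x))"
      using N by (simp add: powr_powr)
    ultimately show "ennreal (G x) = ennreal \<gamma> * (epow (ennreal (\<bar>u x\<bar> powr ps)) ((p - 1) / p) * epow (ennreal (norm (Du x) powr p)) (1 / p))"
      using \<gamma>1 by (simp add: G_def ennreal_mult mult.assoc)
  qed
  also have "\<dots> = ennreal \<gamma> * (\<integral>\<^sup>+ x. epow (ennreal (\<bar>u x\<bar> powr ps)) ((p - 1) / p) * epow (ennreal (norm (Du x) powr p)) (1 / p) \<partial>lborel)"
    by (rule nn_integral_cmult) measurable
  also have "epow \<dots> (conj_exp DIM('a)) \<le> epow (ennreal \<gamma> * (epow A ((p - 1) / p) * epow D (1 / p))) (conj_exp DIM('a))"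
    unfolding A_def D_def using N exps
    by (intro epow_mono mult_left_mono nn_integral_Holder2) (auto simp: field_simps)
  finally have main: "A \<le> epow (ennreal \<gamma> * (epow A ((p - 1) / p) * epow D (1 / p))) (conj_exp DIM('a))" .
  \<comment> \<open>\<open>A\<close> occurs on both sides of \<open>main\<close>; it can be divided
    out only if it is finite, which holds because \<open>u\<close> is bounded with compact
    support.\<close>
  have Afin: "A < \<infinity>"
  proof -
    have "bounded (u ` closure {x. u x \<noteq> 0})"
      by (intro compact_imp_bounded compact_continuous_image comp continuous_on_subset[OF cu]) auto
    then obtain B where B: "\<And>x. x \<in> closure {x. u x \<noteq> 0} \<Longrightarrow> \<bar>u x\<bar> \<le> B" by (auto simp: bounded_iff)
    have "A \<le> (\<integral>\<^sup>+ x. ennreal (\<bar>B\<bar> powr ps) * indicator (closure {x. u x \<noteq> 0}) x \<partial>lborel)"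
      unfolding A_def
    proof (intro nn_integral_mono)
      fix x
      show "ennreal (\<bar>u x\<bar> powr ps) \<le> ennreal (\<bar>B\<bar> powr ps) * indicator (closure {x. u x \<noteq> 0}) x"
      proof (cases "x \<in> closure {x. u x \<noteq> 0}")
        case True
        then show ?thesis using B[OF True] exps by (auto intro!: ennreal_leI powr_mono2)
      next
        case False
        then have "u x = 0" using closure_subset[of "{x. u x \<noteq> 0}"] by auto
        then show ?thesis using exps by simp
      qed
    qed
    also have "\<dots> = ennreal (\<bar>B\<bar> powr ps) * emeasure lborel (closure {x. u x \<noteq> 0})"
      by (simp add: nn_integral_cmult_indicator)
    also have "\<dots> < \<infinity>"
      using emeasure_compact_finite[OF comp] by (simp add: ennreal_mult_less_top)
    finally show ?thesis .
  qed
  have "epow A (p / ps) \<le> ennreal (\<gamma> powr p) * D"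
  proof (cases "A = 0 \<or> D = \<infinity>")
    case True
    then show ?thesis using exps N \<gamma>1 by (auto simp: ennreal_mult_top)
  next
    case False
    then obtain a d where ad: "A = ennreal a" "a > 0" "D = ennreal d" "d \<ge> 0"
      using Afin by (cases A; cases D) (auto simp: less_le)
    let ?c = "conj_exp DIM('a)"
    have "ennreal a \<le> ennreal ((\<gamma> * (a powr ((p - 1) / p) * d powr (1 / p))) powr ?c)"
      using main N \<gamma>1 exps(3) ad by (simp add: ennreal_mult[symmetric])
    then have "a \<le> (\<gamma> * (a powr ((p - 1) / p) * d powr (1 / p))) powr ?c"
      using \<gamma>1 by (subst (asm) ennreal_le_iff) auto
    \<comment> \<open>Raising to the power \<open>p / N'\<close> makes \<open>d\<close> occur
      linearly; dividing by \<open>a powr (p - 1)\<close> then leaves the exponent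
      \<open>p / N' - (p - 1) = p / ps\<close>.\<close>
    then have "a powr (p / ?c) \<le> ((\<gamma> * (a powr ((p - 1) / p) * d powr (1 / p))) powr ?c) powr (p / ?c)"
      using N exps ad by (intro powr_mono2) auto
    also have "\<dots> = (\<gamma> * (a powr ((p - 1) / p) * d powr (1 / p))) powr p"
      using exps(3) by (simp add: powr_powr)
    also have "\<dots> = \<gamma> powr p * (a powr (p - 1) * d)"
      using N \<gamma>1 ad by (simp add: powr_mult powr_powr)
    finally have "a powr (p / ?c) \<le> (\<gamma> powr p * d) * a powr (p - 1)" by (simp add: ac_simps)
    then have "a powr (p / ?c) / a powr (p - 1) \<le> \<gamma> powr p * d" using ad by (simp add: field_simps)
    also have "a powr (p / ?c) / a powr (p - 1) = a powr (p / ?c - (p - 1))" by (simp add: powr_diff)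
    also have "p / ?c - (p - 1) = p / ps" 
      using N by (simp add: ps conj_exp_def N_def[symmetric] divide_simps) (simp add: algebra_simps)
    finally have "a powr (p / ps) \<le> \<gamma> powr p * d" .
    then show ?thesis using ad N exps by (simp add: ennreal_mult[symmetric] ennreal_leI)
  qed
  then show ?thesis by (simp add: A_def D_def \<gamma>_def N_def)
qed

section \<open>Young functions comparable to powers\<close>

text \<open>Monotonicity of the density bounds an increment of \<Phi> by the length times the
  density at either end. Later arguments use these bounds in place of the integral.\<close>

lemma young_functionE:
  assumes "young_function \<Phi>"
  obtains \<phi> where "\<And>t. t > 0 \<Longrightarrow> \<phi> t > (0::real)" "\<phi> 0 = 0"
    "\<And>a b. 0 \<le> a \<Longrightarrow> a \<le> b \<Longrightarrow> (b - a) * \<phi> a \<le> \<Phi> b - \<Phi> a"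
    "\<And>a b. 0 \<le> a \<Longrightarrow> a \<le> b \<Longrightarrow> \<Phi> b - \<Phi> a \<le> (b - a) * \<phi> b"
    "\<Phi> 0 = 0" "\<And>T. continuous_on {0..T} \<Phi>"
proof -
  obtain \<phi> where mono: "mono_on {0..} \<phi>" and zero: "\<And>t. t \<ge> 0 \<Longrightarrow> \<phi> t = 0 \<longleftrightarrow> t = 0"
    and \<Phi>: "\<And>t. t \<ge> 0 \<Longrightarrow> \<Phi> t = integral {0..t} \<phi>"
    using assms unfolding young_function_def by blast
  have int: "\<phi> integrable_on {a..b}" if "0 \<le> a" for a b
    by (rule integrable_on_mono_on[OF mono_on_subset[OF mono]]) (use that in auto)
  have diff: "\<Phi> b - \<Phi> a = integral {a..b} \<phi>" if "0 \<le> a" "a \<le> b" for a b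
    using Henstock_Kurzweil_Integration.integral_combine[OF that int[of 0 b]] that \<Phi>[of a] \<Phi>[of b] by simp
  show thesis
  proof (rule that[of \<phi>])
    fix t :: real assume "t > 0"
    then show "\<phi> t > 0" using mono_onD[OF mono, of 0 t] zero[of 0] zero[of t] by auto
  next
    show "\<phi> 0 = 0" using zero by simp
  next
    fix a b :: real assume ab: "0 \<le> a" "a \<le> b"
    have "(b - a) * \<phi> a = integral {a..b} (\<lambda>_. \<phi> a)" using ab by simp
    also have "\<dots> \<le> integral {a..b} \<phi>"
      using ab by (intro integral_le int integrable_const_ivl) (auto intro: mono_onD[OF mono])
    finally show "(b - a) * \<phi> a \<le> \<Phi> b - \<Phi> a" by (simp add: diff[OF ab])
    have "integral {a..b} \<phi> \<le> integral {a..b} (\<lambda>_. \<phi> b)"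
      using ab by (intro integral_le int integrable_const_ivl) (auto intro: mono_onD[OF mono])
    also have "\<dots> = (b - a) * \<phi> b" using ab by simp
    finally show "\<Phi> b - \<Phi> a \<le> (b - a) * \<phi> b" by (simp add: diff[OF ab])
  next
    show "\<Phi> 0 = 0" using \<Phi>[of 0] by simp
  next
    fix T
    have "continuous_on {0..T} (\<lambda>x. integral {0..x} \<phi>)"
      by (intro indefinite_integral_continuous_1 int) simp
    then show "continuous_on {0..T} \<Phi>"
      by (rule continuous_on_eq) (auto simp: \<Phi>)
  qed
qed

lemma young_function_strict_mono:
  assumes "young_function \<Phi>" "0 \<le> a" "a < b"
  shows "\<Phi> a < \<Phi> b"
proof -
  obtain \<phi> where \<phi>: "\<And>t. t > 0 \<Longrightarrow> \<phi> t > 0" "\<phi> 0 = 0"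
    "\<And>a b. 0 \<le> a \<Longrightarrow> a \<le> b \<Longrightarrow> (b - a) * \<phi> a \<le> \<Phi> b - \<Phi> a"
    "\<And>a b. 0 \<le> a \<Longrightarrow> a \<le> b \<Longrightarrow> \<Phi> b - \<Phi> a \<le> (b - a) * \<phi> b"
    and zero: "\<Phi> 0 = 0" and cont: "\<And>T. continuous_on {0..T} \<Phi>"
    using young_functionE[OF assms(1)] by blast
  \<comment> \<open>The density vanishes at \<open>a\<close> if \<open>a = 0\<close>; it is positive
    at the midpoint, so the right half of the interval gives a strict increase.\<close>
  define m where "m = (a + b) / 2"
  have m: "a < m" "m < b" "0 < m" using assms by (auto simp: m_def)
  have "0 \<le> (m - a) * \<phi> a" using m assms(2) \<phi>(1,2) by (cases "a = 0") (auto intro: less_imp_le)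
  moreover have "0 < (b - m) * \<phi> m" using \<phi>(1) m by simp
  ultimately show ?thesis using \<phi>(3)[of a m] \<phi>(3)[of m b] m assms by linarith
qed

lemma young_function_zero: "young_function \<Phi> \<Longrightarrow> \<Phi> 0 = 0"
  by (erule young_functionE)

lemma young_function_pos: "young_function \<Phi> \<Longrightarrow> t > 0 \<Longrightarrow> \<Phi> t > 0"
  using young_function_strict_mono[of \<Phi> 0 t] young_function_zero by force

lemma young_inv:
  assumes \<Phi>: "young_function \<Phi>" and s: "s \<ge> 0"
  shows "0 \<le> young_inv \<Phi> s" "\<Phi> (young_inv \<Phi> s) = s"
proof -
  obtain \<phi> where \<phi>: "\<And>t. t > 0 \<Longrightarrow> \<phi> t > 0" "\<phi> 0 = 0"
    "\<And>a b. 0 \<le> a \<Longrightarrow> a \<le> b \<Longrightarrow> (b - a) * \<phi> a \<le> \<Phi> b - \<Phi> a"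
    "\<And>a b. 0 \<le> a \<Longrightarrow> a \<le> b \<Longrightarrow> \<Phi> b - \<Phi> a \<le> (b - a) * \<phi> b"
    and zero: "\<Phi> 0 = 0" and cont: "\<And>T. continuous_on {0..T} \<Phi>"
    using young_functionE[OF \<Phi>] by blast
  \<comment> \<open>Beyond 1 the graph lies above a line of slope \<open>\<phi> 1\<close>;
    \<open>T\<close> is where this line has risen by \<open>s\<close>, so the intermediate value
    theorem applies on \<open>{0..T}\<close>.\<close>
  define T where "T = 1 + s / \<phi> 1"
  have T: "T \<ge> 1" using s \<phi>(1)[of 1] by (simp add: T_def)
  have "s = (T - 1) * \<phi> 1" using \<phi>(1)[of 1] by (simp add: T_def)
  also have "\<dots> \<le> \<Phi> T - \<Phi> 1" using T by (intro \<phi>(3)) auto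
  also have "\<dots> \<le> \<Phi> T" using young_function_pos[OF \<Phi>, of 1] by simp
  finally have "\<exists>t\<ge>0. t \<le> T \<and> \<Phi> t = s"
    using T s young_function_zero[OF \<Phi>] by (intro IVT' cont) auto
  then have "\<exists>!t. 0 \<le> t \<and> \<Phi> t = s"
    using young_function_strict_mono[OF \<Phi>] by (metis linorder_neqE order_less_irrefl)
  from theI'[OF this] show "0 \<le> young_inv \<Phi> s" "\<Phi> (young_inv \<Phi> s) = s"
    by (auto simp: young_inv_def)
qed

section \<open>The complementary function and comparison with powers\<close>

lemma young_conj_ge: "s > 0 \<Longrightarrow> ennreal (s * t - \<Phi> s) \<le> young_conj \<Phi> t"
  unfolding young_conj_def by (intro SUP_upper) auto

lemma young_conj_leI: "(\<And>s. s > 0 \<Longrightarrow> s * t - \<Phi> s \<le> r) \<Longrightarrow> young_conj \<Phi> t \<le> ennreal r"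
  unfolding young_conj_def by (intro SUP_least ennreal_leI) auto

text \<open>Young's inequality at \<open>l * a * b\<close> and \<open>\<phi> a * \<phi> b\<close>, with \<open>l\<close> large enough to absorb the
  conjugate term, turns the \<open>\<Delta>'\<close> condition of the conjugate into the reverse of the \<open>\<Delta>'\<close> condition.\<close>

lemma delta_prime_conj_imp_supermultiplicative:
  assumes \<Phi>: "young_function \<Phi>" and dp: "delta_prime \<Phi>" and dpc: "delta_prime_e (young_conj \<Phi>)"
  obtains c where "c > 0" "\<And>a b. a > 0 \<Longrightarrow> b > 0 \<Longrightarrow> c * \<Phi> a * \<Phi> b \<le> \<Phi> (a * b)"
proof -
  obtain \<phi> where \<phi>: "\<And>t. t > 0 \<Longrightarrow> \<phi> t > 0" "\<phi> 0 = 0"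
    "\<And>a b. 0 \<le> a \<Longrightarrow> a \<le> b \<Longrightarrow> (b - a) * \<phi> a \<le> \<Phi> b - \<Phi> a"
    "\<And>a b. 0 \<le> a \<Longrightarrow> a \<le> b \<Longrightarrow> \<Phi> b - \<Phi> a \<le> (b - a) * \<phi> b"
    and zero: "\<Phi> 0 = 0" and cont: "\<And>T. continuous_on {0..T} \<Phi>"
    using young_functionE[OF \<Phi>] by blast
  note pos = young_function_pos[OF \<Phi>]
  obtain C1 where C1: "C1 > 1" "\<And>s t. s \<ge> 0 \<Longrightarrow> t \<ge> 0 \<Longrightarrow> \<Phi> (s * t) \<le> C1 * \<Phi> s * \<Phi> t"
    using dp unfolding delta_prime_def by blast
  obtain C2 where C2: "C2 > 1" "\<And>s t. s \<ge> 0 \<Longrightarrow> t \<ge> 0 \<Longrightarrow>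
      young_conj \<Phi> (s * t) \<le> ennreal C2 * young_conj \<Phi> s * young_conj \<Phi> t"
    using dpc unfolding delta_prime_e_def by blast
  \<comment> \<open>A doubling constant: the \<Delta>' condition with first argument 2 gives
    \<open>\<Phi> (2 * a) \<le> K * \<Phi> a\<close>.\<close>
  define K where "K = C1 * \<Phi> 2"
  have K: "K > 0" using C1 pos[of 2] by (simp add: K_def)
  have lo: "\<Phi> a \<le> a * \<phi> a" and up: "a * \<phi> a \<le> K * \<Phi> a" 
    and conj: "young_conj \<Phi> (\<phi> a) \<le> ennreal (K * \<Phi> a)" if a: "a > 0" for a
  proof -
    show "\<Phi> a \<le> a * \<phi> a" using \<phi>(4)[of 0 a] zero a by simp
    have "a * \<phi> a \<le> \<Phi> (2 * a) - \<Phi> a" using \<phi>(3)[of a "2 * a"] a by simp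
    also have "\<dots> \<le> K * \<Phi> a" using C1(2)[of 2 a] pos[OF a] a by (simp add: K_def)
    finally show *: "a * \<phi> a \<le> K * \<Phi> a" .
    \<comment> \<open>\<open>\<phi> a\<close> is a slope of the convex function \<Phi> at
      \<open>a\<close>, so beyond \<open>a\<close> the difference
      \<open>s * \<phi> a - \<Phi> s\<close> no longer exceeds its value at
      \<open>a\<close>.\<close>
    have "young_conj \<Phi> (\<phi> a) \<le> ennreal (a * \<phi> a)"
    proof (rule young_conj_leI)
      fix s :: real assume s: "s > 0"
      show "s * \<phi> a - \<Phi> s \<le> a * \<phi> a"
      proof (cases "s \<le> a")
        case True
        then have "s * \<phi> a \<le> a * \<phi> a" using \<phi>(1)[OF a] by (intro mult_right_mono) auto
        then show ?thesis using pos[OF s] by linarith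
      next
        case False
        then show ?thesis using \<phi>(3)[of a s] pos[OF a] a by (simp add: algebra_simps)
      qed
    qed
    then show "young_conj \<Phi> (\<phi> a) \<le> ennreal (K * \<Phi> a)"
      using * by (meson ennreal_leI order_trans)
  qed
  \<comment> \<open>The conjugate term is at most \<open>C2 * K\<^sup>2\<close> copies of
    \<open>\<Phi> a * \<Phi> b\<close>, and the product term at least \<open>l\<close> copies; the
    summand 1 leaves exactly one copy.\<close>
  define l where "l = C2 * K\<^sup>2 + 1"
  have l: "l > 0" using C2 K by (simp add: l_def add_pos_pos)
  have main: "\<Phi> a * \<Phi> b \<le> C1 * \<Phi> l * \<Phi> (a * b)" if a: "a > 0" and b: "b > 0" for a b
  proof -
    have "ennreal (l * (a * b) * (\<phi> a * \<phi> b) - \<Phi> (l * (a * b))) \<le> young_conj \<Phi> (\<phi> a * \<phi> b)"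
      using l a b by (intro young_conj_ge) auto
    also have "\<dots> \<le> ennreal C2 * young_conj \<Phi> (\<phi> a) * young_conj \<Phi> (\<phi> b)"
      using \<phi>(1)[OF a] \<phi>(1)[OF b] by (intro C2) auto
    also have "\<dots> \<le> ennreal C2 * ennreal (K * \<Phi> a) * ennreal (K * \<Phi> b)"
      using conj[OF a] conj[OF b] by (intro mult_mono) auto
    also have "\<dots> = ennreal (C2 * (K * \<Phi> a) * (K * \<Phi> b))"
      using C2 K pos[OF a] pos[OF b] by (simp add: ennreal_mult[symmetric])
    finally have "l * (a * b) * (\<phi> a * \<phi> b) - \<Phi> (l * (a * b)) \<le> C2 * (K * \<Phi> a) * (K * \<Phi> b)"
      using C2 K pos[OF a] pos[OF b] by (subst (asm) ennreal_le_iff) auto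
    moreover have "l * (\<Phi> a * \<Phi> b) \<le> l * ((a * \<phi> a) * (b * \<phi> b))"
      using l lo[OF a] lo[OF b] pos[OF a] pos[OF b] \<phi>(1)[OF a] a 
      by (intro mult_left_mono mult_mono) auto
    ultimately have "\<Phi> a * \<Phi> b \<le> \<Phi> (l * (a * b))"
      by (simp add: l_def algebra_simps power2_eq_square)
    also have "\<dots> \<le> C1 * \<Phi> l * \<Phi> (a * b)" using l a b by (intro C1) auto
    finally show ?thesis .
  qed
  show thesis
  proof (rule that[of "1 / (C1 * \<Phi> l)"])
    show "0 < 1 / (C1 * \<Phi> l)" using C1 pos[OF l] by simp
    show "1 / (C1 * \<Phi> l) * \<Phi> a * \<Phi> b \<le> \<Phi> (a * b)" if "a > 0" "b > 0" for a b
      using main[OF that] C1 pos[OF l] by (simp add: field_simps)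
  qed
qed

text \<open>The slope must lie between \<open>(f x - D) / x\<close> and \<open>(f x + D) / x\<close>
  for every positive \<open>x\<close>. Any lower end lies below any upper end, so the supremum of
  the lower ends is a common slope.\<close>

lemma monotone_quasi_additive_near_linear:
  fixes f :: "real \<Rightarrow> real"
  assumes mono: "mono f" and qa: "\<And>x y. \<bar>f (x + y) - f x - f y\<bar> \<le> D"
  obtains p where "\<And>x. \<bar>f x - p * x\<bar> \<le> 3 * D"
proof -
  have D: "D \<ge> 0" using qa[of 0 0] by simp
  have mult: "\<bar>f (real n * x) - real n * f x\<bar> \<le> (real n + 1) * D" for n x
  proof (induction n)
    case 0
    then show ?case using qa[of 0 0] by simp
  next
    case (Suc n)
    have "real (Suc n) * x = real n * x + x" by (simp add: algebra_simps)
    then show ?case using Suc qa[of "real n * x" x] by (simp add: algebra_simps)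
  qed
  have key: "(f y - D) / y \<le> (f x + D) / x" if x: "x > 0" and y: "y > 0" for x y
  proof -
    define z where "z = (x / y) * (f y - D) - (f x + D)"
    have bd: "real n * z \<le> 2 * D + \<bar>f y - D\<bar>" for n
    proof -
      \<comment> \<open>\<open>m\<close> is the number of steps of length \<open>y\<close> that fit
        into \<open>n * x\<close>. Monotonicity compares \<open>f\<close> at \<open>m * y\<close>
        and \<open>n * x\<close>; the remainder \<open>th\<close> stays in \<open>[0, 1]\<close>, so
        \<open>n * z\<close> is bounded independently of \<open>n\<close> and \<open>z\<close>
        cannot be positive.\<close>
      define m where "m = nat \<lfloor>real n * x / y\<rfloor>"
      define th where "th = real n * x / y - real m"
      have th: "0 \<le> th" "th \<le> 1" using x y by (auto simp: th_def m_def) linarith+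
      have "real m * y \<le> real n * x" using th y by (simp add: th_def field_simps)
      then have "f (real m * y) \<le> f (real n * x)" using mono by (auto dest: monoD)
      then have "real m * f y - (real m + 1) * D \<le> real n * f x + (real n + 1) * D"
        using mult[of m y] mult[of n x] by linarith
      moreover have "real m = real n * (x / y) - th" by (simp add: th_def)
      ultimately have "real n * z \<le> 2 * D + th * (f y - D)"
        by (simp add: z_def algebra_simps)
      also have "th * (f y - D) \<le> 1 * \<bar>f y - D\<bar>" using th by (metis abs_ge_self abs_ge_zero mult_mono order_trans mult_left_mono mult_right_mono)
      finally show ?thesis by simp
    qed
    have "z \<le> 0"
    proof (rule ccontr)
      assume "\<not> z \<le> 0"
      then obtain n where "2 * D + \<bar>f y - D\<bar> < real n * z" using ex_less_of_nat_mult[of z] by auto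
      with bd[of n] show False by simp
    qed
    then show ?thesis using x y by (simp add: z_def field_simps)
  qed
  define p where "p = (SUP y\<in>{0<..}. (f y - D) / y)"
  have bdd: "bdd_above ((\<lambda>y. (f y - D) / y) ` {0<..})"
    using key[of 1] by (intro bdd_aboveI2[of _ _ "f 1 + D"]) auto
  have pos: "\<bar>f x - p * x\<bar> \<le> D" if x: "x > 0" for x
  proof -
    have "(f x - D) / x \<le> p" unfolding p_def using x by (intro cSUP_upper[OF _ bdd]) auto
    moreover have "p \<le> (f x + D) / x" unfolding p_def using key[OF x] by (intro cSUP_least) auto
    ultimately show ?thesis using x by (simp add: field_simps abs_le_iff)
  qed
  show thesis
  proof (rule that[of p])
    fix x :: real
    consider "x > 0" | "x = 0" | "- x > 0" by linarith
    then show "\<bar>f x - p * x\<bar> \<le> 3 * D"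
    proof cases
      \<comment> \<open>Reflection costs two more errors \<open>D\<close>: one for splitting
        \<open>0 = x + (- x)\<close>, one for \<open>f 0\<close>.\<close>
      case 3
      then show ?thesis using pos[of "-x"] qa[of x "-x"] qa[of 0 0] by simp
    qed (use pos[of x] qa[of 0 0] D in auto)
  qed
qed

text \<open>In logarithmic coordinates the two bounds become additivity up to \<open>D\<close>.
  Exponentiating the distance \<open>3 * D\<close> from a linear function gives the
  constants.\<close>

lemma quasi_multiplicative_near_power:
  fixes \<Phi> :: "real \<Rightarrow> real"
  assumes pos: "\<And>t. t > 0 \<Longrightarrow> \<Phi> t > 0" and mono: "\<And>s t. 0 < s \<Longrightarrow> s \<le> t \<Longrightarrow> \<Phi> s \<le> \<Phi> t"
    and c: "c > 0" "\<And>a b. a > 0 \<Longrightarrow> b > 0 \<Longrightarrow> c * \<Phi> a * \<Phi> b \<le> \<Phi> (a * b)"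
    and C: "C > 0" "\<And>a b. a > 0 \<Longrightarrow> b > 0 \<Longrightarrow> \<Phi> (a * b) \<le> C * \<Phi> a * \<Phi> b"
  shows "\<exists>p. \<exists>k>0. \<exists>K>0. \<forall>t>0. k * t powr p \<le> \<Phi> t \<and> \<Phi> t \<le> K * t powr p"
proof -
  define f where "f x = ln (\<Phi> (exp x))" for x
  define D where "D = max \<bar>ln c\<bar> \<bar>ln C\<bar>"
  have "mono f" unfolding f_def using mono pos by (intro monoI) auto
  moreover have "\<bar>f (x + y) - f x - f y\<bar> \<le> D" for x y
  proof -
    have "ln (c * \<Phi> (exp x) * \<Phi> (exp y)) \<le> f (x + y)"
      unfolding f_def exp_add using c pos by (subst ln_le_cancel_iff) auto
    moreover have "f (x + y) \<le> ln (C * \<Phi> (exp x) * \<Phi> (exp y))"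
      unfolding f_def exp_add using C pos by (subst ln_le_cancel_iff) auto
    ultimately show ?thesis
      using c(1) C(1) pos[of "exp x"] pos[of "exp y"] by (simp add: f_def D_def ln_mult)
  qed
  ultimately obtain p where p: "\<And>x. \<bar>f x - p * x\<bar> \<le> 3 * D"
    using monotone_quasi_additive_near_linear[of f D] by blast
  have eq: "\<Phi> t = exp (f (ln t))" "t powr p = exp (p * ln t)" if "t > 0" for t
    using that pos by (auto simp: f_def powr_def)
  have "exp (- 3 * D) * t powr p \<le> \<Phi> t \<and> \<Phi> t \<le> exp (3 * D) * t powr p" if "t > 0" for t
    using p[of "ln t"] by (auto simp: eq[OF that] exp_add[symmetric])
  then have "\<forall>t>0. exp (- 3 * D) * t powr p \<le> \<Phi> t \<and> \<Phi> t \<le> exp (3 * D) * t powr p" by blast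
  moreover have "exp (- 3 * D) > 0" "exp (3 * D) > 0" by simp_all
  ultimately show ?thesis by blast
qed

text \<open>If \<open>p \<le> 1\<close>, then \<open>\<Phi> s \<le> K * s\<close> for
  \<open>s \<ge> 1\<close>, so \<open>s * (2 * K) - \<Phi> s\<close> is at least
  \<open>K * s\<close> and the conjugate is infinite at \<open>2 * K\<close>.\<close>

lemma young_conj_finite_imp_superlinear:
  assumes fin: "\<And>t. t \<ge> 0 \<Longrightarrow> young_conj \<Phi> t < \<infinity>" and K: "K > 0" "\<And>t. t > 0 \<Longrightarrow> \<Phi> t \<le> K * t powr p"
  shows "p > 1"
proof (rule ccontr)
  assume "\<not> p > 1"
  obtain r where r: "young_conj \<Phi> (2 * K) = ennreal r" "r \<ge> 0"
    using fin[of "2 * K"] K by (cases "young_conj \<Phi> (2 * K)") auto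
  define s where "s = 1 + (r + 1) / K"
  have s: "s \<ge> 1" using r K by (simp add: s_def)
  have "s powr p \<le> s powr 1" using s \<open>\<not> p > 1\<close> by (intro powr_mono) auto
  then have "K * s powr p \<le> K * s" using K(1) s by simp
  then have "\<Phi> s \<le> K * s" using K(2)[of s] s by simp
  then have "ennreal (K * s) \<le> ennreal (s * (2 * K) - \<Phi> s)" by (intro ennreal_leI) (simp add: algebra_simps)
  also have "\<dots> \<le> ennreal r" unfolding r(1)[symmetric] using s by (intro young_conj_ge) auto
  finally have "K * s \<le> r" using r by (simp add: ennreal_le_iff)
  moreover have "K * s = K + r + 1" using K(1) by (simp add: s_def field_simps)
  ultimately show False using K(1) by simp
qed

text \<open>Test the supremum at the \<open>s\<close> where \<open>K * s powr p\<close> is half of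
  \<open>s * t\<close>; the other half remains and is a multiple of the conjugate power.\<close>

lemma young_conj_power_lower:
  assumes p: "p > 1" and K: "K > 0" "\<And>t. t > 0 \<Longrightarrow> \<Phi> t \<le> K * t powr p"
  obtains k where "k > 0" "\<And>t. t > 0 \<Longrightarrow> ennreal (k * t powr (p / (p - 1))) \<le> young_conj \<Phi> t"
proof (rule that[of "(2 * K) powr (- 1 / (p - 1)) / 2"])
  show "(2 * K) powr (- 1 / (p - 1)) / 2 > 0" using K by simp
  fix t :: real assume t: "t > 0"
  define s where "s = (t / (2 * K)) powr (1 / (p - 1))"
  have s: "s > 0" using t K by (simp add: s_def)
  have "s powr (p - 1) = t / (2 * K)" using p t K by (simp add: s_def powr_powr)
  moreover have "s powr p = s * s powr (p - 1)" using s by (simp add: powr_diff)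
  ultimately have "K * s powr p = s * t / 2" using K by simp
  then have "s * t / 2 \<le> s * t - \<Phi> s" using K(2)[OF s] by simp
  moreover have "(2 * K) powr (- 1 / (p - 1)) / 2 * t powr (p / (p - 1)) = s * t / 2"
  proof -
    have "p / (p - 1) = 1 / (p - 1) + 1" using p by (simp add: field_simps)
    then have "t powr (p / (p - 1)) = t powr (1 / (p - 1)) * t" using t by (simp add: powr_add)
    then show ?thesis using t K by (simp add: s_def powr_divide powr_minus divide_simps)
  qed
  ultimately show "ennreal ((2 * K) powr (- 1 / (p - 1)) / 2 * t powr (p / (p - 1))) \<le> young_conj \<Phi> t"
    using young_conj_ge[OF s, of t \<Phi>] by (metis ennreal_leI order_trans)
qed

section \<open>The Sobolev conjugate of a power\<close>

text \<open>Integrating over \<open>{t/2..t}\<close> alone stays away from the singularity at 0 and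
  already yields the right power of \<open>t\<close>.\<close>

lemma H_fun_ge_dyadic:
  assumes k: "k > 0" "\<And>t. t > 0 \<Longrightarrow> ennreal (k * t powr p') \<le> young_conj \<Phi> t"
    and e: "e = p' - conj_exp N" "e > 0" and t: "t > 0"
  shows "ennreal (k * (1 - 2 powr (- e)) / e * t powr e) \<le> H_fun N \<Phi> t"
proof -
  have "((\<lambda>s. k * s powr (e - 1)) has_integral k * t powr e / e - k * (t / 2) powr e / e) {t/2..t}"
  proof (rule fundamental_theorem_of_calculus)
    fix s assume "s \<in> {t/2..t}"
    then have "s > 0" using t by auto
    then show "((\<lambda>s. k * s powr e / e) has_vector_derivative k * s powr (e - 1)) (at s within {t/2..t})"
      using e unfolding has_real_derivative_iff_has_vector_derivative[symmetric]
      by (auto intro!: derivative_eq_intros)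
  qed (use t in auto)
  from nn_integral_has_integral_lebesgue'[OF _ this]
  have "ennreal (k * t powr e / e - k * (t / 2) powr e / e)
      = (\<integral>\<^sup>+ s\<in>{t/2..t}. ennreal (k * s powr (e - 1)) \<partial>lborel)"
    using k by simp
  also have "\<dots> \<le> H_fun N \<Phi> t"
    unfolding H_fun_def
  proof (intro nn_integral_mono)
    fix s
    show "ennreal (k * s powr (e - 1)) * indicator {t/2..t} s
      \<le> young_conj \<Phi> s / ennreal (s powr (1 + conj_exp N)) * indicator {0<..t} s"
    proof (cases "s \<in> {t/2..t}")
      case True
      then have s: "s > 0" "s \<le> t" using t by auto
      have "s powr (e - 1) = s powr p' / s powr (1 + conj_exp N)"
        using s by (simp add: powr_diff[symmetric] e(1) algebra_simps)
      then have "ennreal (k * s powr (e - 1)) = ennreal (k * s powr p') / ennreal (s powr (1 + conj_exp N))"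
        using k s by (simp add: divide_ennreal)
      also have "\<dots> \<le> young_conj \<Phi> s / ennreal (s powr (1 + conj_exp N))"
        using k(2)[OF s(1)] by (rule divide_right_mono_ennreal)
      finally show ?thesis using s by (simp add: indicator_def)
    qed simp
  qed
  also have "k * t powr e / e - k * (t / 2) powr e / e = k * (1 - 2 powr (- e)) / e * t powr e"
    using t e by (simp add: powr_divide powr_minus field_simps)
  finally show ?thesis .
qed

text \<open>On \<open>(0, 1]\<close> the integrand is at least \<open>k / s\<close>, which has a
  logarithmic divergence at 0.\<close>

lemma H_fun_eq_top:
  assumes k: "k > 0" "\<And>t. t > 0 \<Longrightarrow> ennreal (k * t powr p') \<le> young_conj \<Phi> t"
    and e: "p' \<le> conj_exp N" and t: "0 < t" "t \<le> 1"
  shows "H_fun N \<Phi> t = \<infinity>"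
proof -
  have bound: "ennreal (k * y) \<le> H_fun N \<Phi> t" if y: "y > 0" for y
  proof -
    \<comment> \<open>Chosen so that the integral of \<open>k / s\<close> over \<open>{d..t}\<close>
      is exactly \<open>k * y\<close>.\<close>
    define d where "d = t * exp (- y)"
    have d: "0 < d" "d \<le> t" using t y by (auto simp: d_def)
    have "((\<lambda>s. k / s) has_integral k * ln t - k * ln d) {d..t}"
    proof (rule fundamental_theorem_of_calculus)
      fix s assume "s \<in> {d..t}"
      then have "s > 0" using d by auto
      then show "((\<lambda>s. k * ln s) has_vector_derivative k / s) (at s within {d..t})"
        unfolding has_real_derivative_iff_has_vector_derivative[symmetric]
        by (auto intro!: derivative_eq_intros)
    qed (use d in auto)
    from nn_integral_has_integral_lebesgue'[OF _ this]
    have "ennreal (k * ln t - k * ln d) = (\<integral>\<^sup>+ s\<in>{d..t}. ennreal (k / s) \<partial>lborel)"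
      using k d by simp
    also have "\<dots> \<le> H_fun N \<Phi> t"
      unfolding H_fun_def
    proof (intro nn_integral_mono)
      fix s
      show "ennreal (k / s) * indicator {d..t} s
        \<le> young_conj \<Phi> s / ennreal (s powr (1 + conj_exp N)) * indicator {0<..t} s"
      proof (cases "s \<in> {d..t}")
        case True
        then have s: "s > 0" "s \<le> t" "s \<le> 1" using t d by auto
        have "s powr conj_exp N \<le> s powr p'" using s e by (intro powr_mono') auto
        then have "1 / s \<le> s powr p' / s powr (1 + conj_exp N)"
          using s by (simp add: powr_add field_simps)
        then have "ennreal (k / s) \<le> ennreal (k * (s powr p' / s powr (1 + conj_exp N)))"
          using k(1) mult_left_mono[of "1 / s" "s powr p' / s powr (1 + conj_exp N)" k] 
          by (intro ennreal_leI) simp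
        also have "\<dots> = ennreal (k * s powr p') / ennreal (s powr (1 + conj_exp N))"
          using k s by (simp add: divide_ennreal)
        also have "\<dots> \<le> young_conj \<Phi> s / ennreal (s powr (1 + conj_exp N))"
          using k(2)[OF s(1)] by (rule divide_right_mono_ennreal)
        finally show ?thesis using s by (simp add: indicator_def)
      qed simp
    qed
    also have "k * ln t - k * ln d = k * y" using t by (simp add: d_def ln_mult algebra_simps)
    finally show ?thesis .
  qed
  show ?thesis
  proof (rule ccontr)
    assume "H_fun N \<Phi> t \<noteq> \<infinity>"
    then obtain r where r: "H_fun N \<Phi> t = ennreal r" "r \<ge> 0" by (cases "H_fun N \<Phi> t") auto
    then have "k * ((r + 1) / k) \<le> r" using bound[of "(r + 1) / k"] k(1) by (simp add: ennreal_le_iff)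
    then show False using k by simp
  qed
qed

lemma H_inv_pow_le:
  assumes "0 \<le> t" "ennreal r \<le> H_fun N \<Phi> t"
  shows "H_inv_pow N \<Phi> r \<le> ennreal (t powr conj_exp N)"
  unfolding H_inv_pow_def using assms by (intro INF_lower) auto

text \<open>If \<open>H_fun\<close> is infinite arbitrarily close to 0, it reaches every level
  there, so its generalized inverse is 0.\<close>

lemma Phi_N_eq_0:
  assumes top: "\<And>t. 0 < t \<Longrightarrow> t \<le> 1 \<Longrightarrow> H_fun N \<Phi> t = \<infinity>" and N: "conj_exp N > 0"
  shows "Phi_N N \<Phi> t = 0"
proof -
  have "H_inv_pow N \<Phi> r = 0" for r
  proof -
    have "H_inv_pow N \<Phi> r \<le> 0 + ennreal d" if d: "d > 0" for d
    proof -
      define t where "t = min 1 (d powr (1 / conj_exp N))"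
      have t: "0 < t" "t \<le> 1" using d by (auto simp: t_def)
      have "t powr conj_exp N \<le> (d powr (1 / conj_exp N)) powr conj_exp N"
        using N t by (intro powr_mono2) (auto simp: t_def)
      also have "\<dots> = d" using N d by (simp add: powr_powr)
      finally have "ennreal (t powr conj_exp N) \<le> ennreal d" by (rule ennreal_leI)
      moreover have "H_inv_pow N \<Phi> r \<le> ennreal (t powr conj_exp N)"
        using t by (intro H_inv_pow_le) (auto simp: top)
      ultimately show ?thesis by simp
    qed
    then have "H_inv_pow N \<Phi> r \<le> 0" by (rule ennreal_le_epsilon)
    then show ?thesis by simp
  qed
  then show ?thesis by (simp add: Phi_N_def)
qed

text \<open>A lower bound for \<open>H_fun\<close> is an upper bound for its inverse, which makes
  the integrand at most an increasing power of \<open>s\<close>.\<close>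

lemma Phi_N_le_power:
  assumes c: "c > 0" "\<And>t. t > 0 \<Longrightarrow> ennreal (c * t powr e) \<le> H_fun N \<Phi> t"
    and e: "e > 0" and N: "conj_exp N > 1" and t: "t \<ge> 0"
  defines "N' \<equiv> conj_exp N"
  shows "Phi_N N \<Phi> t \<le> ennreal (c powr (- N' / e) * t powr (N' + N' * N' / e))"
proof -
  have inv: "H_inv_pow N \<Phi> r \<le> ennreal ((r / c) powr (N' / e))" if r: "r \<ge> 0" for r
  proof (cases "r = 0")
    case True
    then show ?thesis using H_inv_pow_le[of 0 r N \<Phi>] by simp
  next
    case False
    define s where "s = (r / c) powr (1 / e)"
    have s: "s > 0" "c * s powr e = r" using c(1) e r False by (auto simp: s_def powr_powr)
    have "H_inv_pow N \<Phi> r \<le> ennreal (s powr N')"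
      unfolding N'_def using c(2)[OF s(1)] s by (intro H_inv_pow_le) auto
    then show ?thesis by (simp add: s_def powr_powr)
  qed
  \<comment> \<open>The value of the increasing bound at the right end \<open>t\<close>; multiplied
    by the length \<open>t\<close> it bounds the integral.\<close>
  define M where "M = t powr (N' - 1) * (t powr N' / c) powr (N' / e)"
  have "Phi_N N \<Phi> t \<le> (\<integral>\<^sup>+ s. ennreal M * indicator {0..t} s \<partial>lborel)"
    unfolding Phi_N_def
  proof (intro nn_integral_mono)
    fix s
    show "ennreal (s powr (conj_exp N - 1)) * H_inv_pow N \<Phi> (s powr conj_exp N) * indicator {0..t} s
      \<le> ennreal M * indicator {0..t} s"
    proof (cases "s \<in> {0..t}")
      case True
      have "ennreal (s powr (N' - 1)) * H_inv_pow N \<Phi> (s powr N')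
         \<le> ennreal (s powr (N' - 1)) * ennreal ((s powr N' / c) powr (N' / e))"
        by (intro mult_left_mono inv) auto
      also have "\<dots> = ennreal (s powr (N' - 1) * (s powr N' / c) powr (N' / e))"
        by (simp add: ennreal_mult)
      also have "\<dots> \<le> ennreal M"
        unfolding M_def using True c(1) e N unfolding N'_def
        by (intro ennreal_leI mult_mono powr_mono2 divide_right_mono) auto
      finally show ?thesis using True by (simp add: N'_def)
    qed simp
  qed
  also have "\<dots> = ennreal (M * t)"
    using t by (simp add: nn_integral_cmult_indicator ennreal_mult M_def)
  also have "M * t = c powr (- N' / e) * t powr (N' + N' * N' / e)"
  proof (cases "t = 0")
    case False
    then have "t > 0" using t by simp
    have "N' + N' * N' / e = (N' - 1) + 1 + N' * (N' / e)" by simp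
    then have "t powr (N' + N' * N' / e) = t powr (N' - 1) * t * t powr (N' * (N' / e))"
      using \<open>t > 0\<close> by (simp only: powr_add powr_one)
    moreover have "(t powr N' / c) powr (N' / e) = t powr (N' * (N' / e)) * c powr (- N' / e)"
      using c(1) by (simp add: powr_divide powr_powr powr_minus_divide)
    ultimately show ?thesis by (simp only: M_def ac_simps)
  qed simp
  finally show ?thesis .
qed

section \<open>Measurability and finiteness facts for Orlicz spaces\<close>

lemma borel_measurable_young_conj: "young_conj F \<in> borel_measurable borel"
proof (rule borel_measurableI_greater)
  fix y :: ennreal
  \<comment> \<open>A supremum of functions continuous in \<open>x\<close> is lower semicontinuous:
    its strict superlevel sets are unions of open sets.\<close>
  have "{x \<in> space borel. y < young_conj F x} = (\<Union>s\<in>{0<..}. {x. y < ennreal (s * x - F s)})"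
    by (auto simp: young_conj_def less_SUP_iff)
  also have "open \<dots>"
    by (intro open_UN ballI open_Collect_less continuous_on_ennreal continuous_intros)
  finally show "{x \<in> space borel. y < young_conj F x} \<in> sets borel" by simp
qed

lemma borel_measurable_compose_indicator:
  assumes "\<Omega> \<in> sets lebesgue" "g \<in> borel_measurable (lebesgue_on \<Omega>)" "h \<in> borel_measurable borel"
  shows "(\<lambda>x. h (g x) * indicator \<Omega> x :: ennreal) \<in> borel_measurable lebesgue"
  using measurable_compose[OF assms(2,3)] assms(1)
  by (simp add: borel_measurable_restrict_space_iff_ennreal)

text \<open>The Luxemburg norm is a real \<open>Inf\<close>, meaningful only over a nonempty set. As
  \<open>F\<close> is nonnegative, dividing the argument of the conjugate by
  \<open>l \<ge> 1\<close> divides its value by at least \<open>l\<close>; with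
  \<open>l = r + 1\<close> the integral \<open>r\<close> drops to at most 1.\<close>

lemma luxemburg_set_nonempty:
  assumes F: "\<And>s. s > 0 \<Longrightarrow> F s \<ge> 0" and \<Omega>: "\<Omega> \<in> sets lebesgue" and g: "g \<in> orlicz_space (young_conj F) \<Omega>"
  shows "\<exists>c>0. (\<integral>\<^sup>+ x\<in>\<Omega>. young_conj F (\<bar>g x\<bar> / c) \<partial>lebesgue) \<le> 1"
proof -
  obtain c where c: "c > 0" "(\<integral>\<^sup>+ x\<in>\<Omega>. young_conj F (\<bar>g x\<bar> / c) \<partial>lebesgue) < \<infinity>"
    using g by (auto simp: orlicz_space_def)
  then obtain r where r: "(\<integral>\<^sup>+ x\<in>\<Omega>. young_conj F (\<bar>g x\<bar> / c) \<partial>lebesgue) = ennreal r" "r \<ge> 0"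
    by (cases "\<integral>\<^sup>+ x\<in>\<Omega>. young_conj F (\<bar>g x\<bar> / c) \<partial>lebesgue") auto
  define l where "l = r + 1"
  have l: "l \<ge> 1" using r by (simp add: l_def)
  have scale: "ennreal l * young_conj F (t / l) \<le> young_conj F t" for t
  proof -
    have "ennreal l * young_conj F (t / l) = (SUP s\<in>{0<..}. ennreal l * ennreal (s * (t / l) - F s))"
      unfolding young_conj_def by (rule SUP_mult_left_ennreal)
    also have "\<dots> \<le> young_conj F t"
    proof (rule SUP_least)
      fix s :: real assume "s \<in> {0<..}"
      then have s: "s > 0" by simp
      have "l * (s * (t / l) - F s) \<le> s * t - F s"
        using l F[OF s] mult_right_mono[of 1 l "F s"] by (simp add: algebra_simps)
      then have "ennreal l * ennreal (s * (t / l) - F s) \<le> ennreal (s * t - F s)"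
        using l by (simp add: ennreal_mult'[symmetric] ennreal_leI)
      also have "\<dots> \<le> young_conj F t" by (rule young_conj_ge[OF s])
      finally show "ennreal l * ennreal (s * (t / l) - F s) \<le> young_conj F t" .
    qed
    finally show ?thesis .
  qed
  have inv: "ennreal (1 / l) * ennreal l = 1" using l by (simp flip: ennreal_mult)
  have le: "young_conj F (\<bar>g x\<bar> / (c * l)) \<le> young_conj F (\<bar>g x\<bar> / c) * ennreal (1 / l)" for x
  proof -
    have "young_conj F (\<bar>g x\<bar> / c / l) = ennreal (1 / l) * (ennreal l * young_conj F (\<bar>g x\<bar> / c / l))"
      using inv by (simp only: mult.assoc[symmetric] mult_1)
    also have "\<dots> \<le> ennreal (1 / l) * young_conj F (\<bar>g x\<bar> / c)"
      by (intro mult_left_mono scale) auto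
    finally show ?thesis by (simp only: divide_divide_eq_left mult.commute[of _ "ennreal (1 / l)"])
  qed
  have "(\<integral>\<^sup>+ x\<in>\<Omega>. young_conj F (\<bar>g x\<bar> / (c * l)) \<partial>lebesgue)
     \<le> (\<integral>\<^sup>+ x. (young_conj F (\<bar>g x\<bar> / c) * indicator \<Omega> x) * ennreal (1 / l) \<partial>lebesgue)"
    using le by (intro nn_integral_mono) (simp add: indicator_def)
  also have "\<dots> = ennreal r * ennreal (1 / l)"
  proof -
    have "(\<lambda>x. young_conj F (\<bar>g x\<bar> / c) * indicator \<Omega> x) \<in> borel_measurable lebesgue"
      using g borel_measurable_young_conj[of F]
      by (intro borel_measurable_compose_indicator[OF \<Omega>, where g = g and h = "\<lambda>t. young_conj F (\<bar>t\<bar> / c)"])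
         (simp_all add: orlicz_space_def)
    then show ?thesis using r by (simp add: nn_integral_multc)
  qed
  also have "\<dots> \<le> 1" using l r by (simp add: ennreal_mult[symmetric] l_def)
  finally show ?thesis using c l by (intro exI[of _ "c * l"]) auto
qed

section \<open>Power bounds for \<Phi> and for the conjugate of \<open>B_Phi_real\<close>\<close>

lemma multiplicative_young_function_power:
  assumes \<Phi>: "young_function \<Phi>" and dp: "delta_prime \<Phi>" and dpc: "delta_prime_e (young_conj \<Phi>)"
  obtains p k K where "1 < p" "0 < k" "0 < K" 
    "\<And>t. 0 \<le> t \<Longrightarrow> k * t powr p \<le> \<Phi> t" "\<And>t. 0 \<le> t \<Longrightarrow> \<Phi> t \<le> K * t powr p"
proof -
  obtain c where c: "c > 0" "\<And>a b. a > 0 \<Longrightarrow> b > 0 \<Longrightarrow> c * \<Phi> a * \<Phi> b \<le> \<Phi> (a * b)"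
    using delta_prime_conj_imp_supermultiplicative[OF assms] by blast
  obtain C where C: "C > 1" "\<And>a b. a \<ge> 0 \<Longrightarrow> b \<ge> 0 \<Longrightarrow> \<Phi> (a * b) \<le> C * \<Phi> a * \<Phi> b"
    using dp unfolding delta_prime_def by blast
  have mono: "\<Phi> s \<le> \<Phi> t" if "0 < s" "s \<le> t" for s t
    using young_function_strict_mono[OF \<Phi>, of s t] that by (cases "s = t") auto
  have C': "C > 0" "\<And>a b. a > 0 \<Longrightarrow> b > 0 \<Longrightarrow> \<Phi> (a * b) \<le> C * \<Phi> a * \<Phi> b"
    using C(1) by (simp, intro C(2) less_imp_le)
  obtain k K p where pkK: "k > 0" "K > 0" "\<And>t. t > 0 \<Longrightarrow> k * t powr p \<le> \<Phi> t" "\<And>t. t > 0 \<Longrightarrow> \<Phi> t \<le> K * t powr p"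
  proof -
    have "\<exists>p. \<exists>k>0. \<exists>K>0. \<forall>t>0. k * t powr p \<le> \<Phi> t \<and> \<Phi> t \<le> K * t powr p"
      by (rule quasi_multiplicative_near_power[OF young_function_pos[OF \<Phi>] mono c C'])
    then show thesis using that by blast
  qed
  have "p > 1"
  proof (rule young_conj_finite_imp_superlinear[OF _ pkK(2,4)])
    show "young_conj \<Phi> t < \<infinity>" if "t \<ge> 0" for t
      using dpc that unfolding delta_prime_e_def by blast
  qed
  moreover have "k * t powr p \<le> \<Phi> t" "\<Phi> t \<le> K * t powr p" if "t \<ge> 0" for t
    using pkK(3)[of t] pkK(4)[of t] young_function_zero[OF \<Phi>] that by (cases "t = 0"; simp)+
  ultimately show thesis using pkK(1,2) by (intro that)
qed

text \<open>Each bound reverses the previous one: the conjugate of \<Phi> is bounded below by a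
  power, hence so is \<open>H_fun\<close>, hence \<open>Phi_N\<close> and \<open>B_Phi_real\<close>
  are bounded above, hence the conjugate of \<open>B_Phi_real\<close> below.\<close>

lemma B_Phi_conj_power_lower:
  assumes \<Phi>: "young_function \<Phi>" and p: "p > 1" and k: "k > 0" and K: "K > 0"
    and lo: "\<And>t. 0 \<le> t \<Longrightarrow> k * t powr p \<le> \<Phi> t" and up: "\<And>t. 0 \<le> t \<Longrightarrow> \<Phi> t \<le> K * t powr p"
    and N: "N \<ge> 2" and B: "young_function (B_Phi_real N \<Phi>)"
  obtains b where "p < real N" "b > 0"
    "\<And>t. t \<ge> 0 \<Longrightarrow> ennreal (b * t powr (real N / p)) \<le> young_conj (B_Phi_real N \<Phi>) t"
proof -
  define N' where "N' = conj_exp N"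
  define p' where "p' = p / (p - 1)"
  have N': "N' > 1" using N by (simp add: N'_def conj_exp_def field_simps)
  obtain h where h: "h > 0" "\<And>t. t > 0 \<Longrightarrow> ennreal (h * t powr p') \<le> young_conj \<Phi> t"
    unfolding p'_def using young_conj_power_lower[OF p K up[OF less_imp_le]] by blast
  \<comment> \<open>This inequality between conjugate exponents means \<open>p < N\<close>; without
    it \<open>B_Phi_real\<close> would vanish at 1.\<close>
  have gap: "N' < p'"
  proof (rule ccontr)
    assume "\<not> N' < p'"
    then have "H_fun N \<Phi> t = \<infinity>" if "0 < t" "t \<le> 1" for t
      using H_fun_eq_top[OF h _ that] by (simp add: N'_def)
    then have "Phi_N N \<Phi> t = 0" for t using N' by (intro Phi_N_eq_0) (auto simp: N'_def)
    then have "B_Phi_real N \<Phi> 1 = 0" by (simp add: B_Phi_real_def B_Phi_def)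
    then show False using young_function_pos[OF B, of 1] by simp
  qed
  then have pN: "p < real N" using p N by (simp add: N'_def p'_def conj_exp_def field_simps)
  define e where "e = p' - N'"
  have e: "e > 0" using gap by (simp add: e_def)
  define c where "c = h * (1 - 2 powr (- e)) / e"
  have "2 powr (- e) < 2 powr 0" using e by (subst powr_less_cancel_iff) auto
  then have c: "c > 0" using h e by (simp add: c_def)
  have H: "ennreal (c * t powr e) \<le> H_fun N \<Phi> t" if "t > 0" for t
    unfolding c_def using e that by (intro H_fun_ge_dyadic[OF h]) (simp_all add: e_def N'_def)
  define A where "A = c powr (- N' / e)"
  define ps where "ps = N' + N' * N' / e"
  \<comment> \<open>The exponent produced by the integration is the Sobolev exponent of
    \<open>p\<close>.\<close>
  have ps: "ps = real N * p / (real N - p)"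
  proof -
    have "e = (real N - p) / ((p - 1) * (real N - 1))"
      using p N by (simp add: e_def p'_def N'_def conj_exp_def divide_simps) (simp add: algebra_simps)
    moreover have "N' = real N / (real N - 1)" by (simp add: N'_def conj_exp_def)
    moreover have "p' = p / (p - 1)" by (simp add: p'_def)
    moreover have "ps = N' * p' / e" using e by (simp add: ps_def e_def field_simps)
    ultimately show ?thesis using p N by simp
  qed
  have PhiN: "Phi_N N \<Phi> t \<le> ennreal (A * t powr ps)" if "t \<ge> 0" for t
    unfolding A_def ps_def N'_def using N' by (intro Phi_N_le_power c H e that) (simp_all add: N'_def)
  \<comment> \<open>\<open>q' = ps / p\<close>, since the inverse of \<Phi> grows at most like
    \<open>t powr (1 / p)\<close>; its conjugate exponent is \<open>N / p\<close>.\<close>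
  define q' where "q' = real N / (real N - p)"
  have q': "q' > 1" using p pN by (simp add: q'_def)
  define L where "L = A * (1 / k) powr q'"
  have L: "L > 0" using c k by (simp add: L_def A_def)
  have Bup: "B_Phi_real N \<Phi> t \<le> L * t powr q'" if t: "t > 0" for t
  proof -
    define v where "v = young_inv \<Phi> t"
    have v: "v \<ge> 0" "\<Phi> v = t" using young_inv[OF \<Phi>, of t] t by (auto simp: v_def)
    have "v powr p \<le> t / k" using lo[OF v(1)] v k by (simp add: field_simps)
    then have "(v powr p) powr q' \<le> (t / k) powr q'" using q' by (intro powr_mono2) auto
    also have "(v powr p) powr q' = v powr ps" by (simp add: powr_powr ps q'_def mult.commute)
    also have "(t / k) powr q' = (1 / k) powr q' * t powr q'" using t k by (simp flip: powr_mult)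
    finally have "A * v powr ps \<le> L * t powr q'" 
      unfolding L_def mult.assoc by (intro mult_left_mono) (auto simp: A_def)
    then have "B_Phi N \<Phi> t \<le> ennreal (L * t powr q')"
      using PhiN[OF v(1)] unfolding B_Phi_def v_def[symmetric] by (meson ennreal_leI order_trans)
    then show ?thesis unfolding B_Phi_real_def using L by (intro enn2real_leI) auto
  qed
  obtain b where b: "b > 0" "\<And>t. t > 0 \<Longrightarrow> ennreal (b * t powr (q' / (q' - 1))) \<le> young_conj (B_Phi_real N \<Phi>) t"
    using young_conj_power_lower[OF q' L Bup] by blast
  have "q' / (q' - 1) = real N / p" using p pN N by (simp add: q'_def field_simps)
  with b have "ennreal (b * t powr (real N / p)) \<le> young_conj (B_Phi_real N \<Phi>) t" if "t \<ge> 0" for t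
    using that by (cases "t = 0") auto
  then show thesis using that pN b(1) by blast
qed

text \<open>Allows the gradient integral of the Sobolev inequality, taken over the whole space, to
  be bounded by one over \<Omega>. Near a point outside \<Omega> the function \<open>u\<close> is
  identically 0.\<close>

lemma C1c_grad_outside:
  assumes "C1c_with_grad \<Omega> u Du" "x \<notin> \<Omega>"
  shows "Du x = 0"
proof -
  let ?S = "- closure {x. u x \<noteq> 0}"
  have x: "x \<in> ?S" using assms by (auto simp: C1c_with_grad_def)
  have "(u has_derivative (\<lambda>h. Du x \<bullet> h)) (at x)" using assms by (simp add: C1c_with_grad_def)
  moreover have "(u has_derivative (\<lambda>h. 0)) (at x)"
  proof (rule has_derivative_transform_within_open[of "\<lambda>_. 0" _ _ _ ?S])
    show "0 = u y" if "y \<in> ?S" for y using that closure_subset[of "{x. u x \<noteq> 0}"] by auto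
  qed (use x in auto)
  ultimately have "(\<lambda>h. Du x \<bullet> h) = (\<lambda>h. 0)" by (rule has_derivative_unique)
  from fun_cong[OF this, of "Du x"] show ?thesis by simp
qed

text \<open>For each admissible \<open>c\<close> the lower bound on the conjugate turns the modular
  condition into a bound by \<open>b powr (- 1 / q) * c\<close> on the \<open>q\<close>-norm of
  \<open>g\<close>. The infimum over \<open>c\<close> preserves it.\<close>

lemma luxemburg_norm_power_bound:
  fixes \<Omega> :: "'a::euclidean_space set"
  assumes F: "\<And>s. s > 0 \<Longrightarrow> F s \<ge> 0" and \<Omega>: "\<Omega> \<in> sets lebesgue" and g: "g \<in> orlicz_space (young_conj F) \<Omega>"
    and b: "b > 0" "\<And>t. t \<ge> 0 \<Longrightarrow> ennreal (b * t powr q) \<le> young_conj F t" and q: "q > 0"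
  shows "epow (\<integral>\<^sup>+ x. ennreal (\<bar>g x\<bar> powr q) * indicator \<Omega> x \<partial>lebesgue) (1 / q)
    \<le> ennreal (b powr (- 1 / q) * luxemburg_norm (young_conj F) \<Omega> g)"
proof -
  define G where "G = (\<integral>\<^sup>+ x. ennreal (\<bar>g x\<bar> powr q) * indicator \<Omega> x \<partial>lebesgue)"
  define S where "S = {c. c > 0 \<and> (\<integral>\<^sup>+ x\<in>\<Omega>. young_conj F (\<bar>g x\<bar> / c) \<partial>lebesgue) \<le> 1}"
  have le: "epow G (1 / q) \<le> ennreal (b powr (- 1 / q) * c)" if "c \<in> S" for c
  proof -
    have c: "c > 0" "(\<integral>\<^sup>+ x\<in>\<Omega>. young_conj F (\<bar>g x\<bar> / c) \<partial>lebesgue) \<le> 1" using that by (auto simp: S_def)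
    have "G = (\<integral>\<^sup>+ x. ennreal (c powr q / b) * (ennreal (b * (\<bar>g x\<bar> / c) powr q) * indicator \<Omega> x) \<partial>lebesgue)"
      unfolding G_def
    proof (intro nn_integral_cong)
      fix x
      have "\<bar>g x\<bar> powr q = (c powr q / b) * (b * (\<bar>g x\<bar> / c) powr q)"
        using c b by (simp add: powr_divide)
      then show "ennreal (\<bar>g x\<bar> powr q) * indicator \<Omega> x
        = ennreal (c powr q / b) * (ennreal (b * (\<bar>g x\<bar> / c) powr q) * indicator \<Omega> x)"
        using b by (simp add: ennreal_mult[symmetric] mult.assoc[symmetric])
    qed
    also have "\<dots> = ennreal (c powr q / b) * (\<integral>\<^sup>+ x. ennreal (b * (\<bar>g x\<bar> / c) powr q) * indicator \<Omega> x \<partial>lebesgue)"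
      using g
      by (intro nn_integral_cmult borel_measurable_compose_indicator
            [OF \<Omega>, where g = g and h = "\<lambda>t. ennreal (b * (\<bar>t\<bar> / c) powr q)"])
         (simp_all add: orlicz_space_def)
    also have "\<dots> \<le> ennreal (c powr q / b) * (\<integral>\<^sup>+ x\<in>\<Omega>. young_conj F (\<bar>g x\<bar> / c) \<partial>lebesgue)"
      using b(2) c(1) by (intro mult_left_mono nn_integral_mono mult_right_mono) auto
    also have "\<dots> \<le> ennreal (c powr q / b) * 1" using c(2) by (intro mult_left_mono) auto
    finally have "G \<le> ennreal (c powr q / b)" by simp
    then have "epow G (1 / q) \<le> epow (ennreal (c powr q / b)) (1 / q)" using q by (intro epow_mono) auto
    also have "\<dots> = ennreal ((c powr q / b) powr (1 / q))" using q b by simp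
    also have "(c powr q / b) powr (1 / q) = b powr (- 1 / q) * c"
      using c b q by (simp add: powr_divide powr_powr powr_minus_divide)
    finally show ?thesis .
  qed
  have "S \<noteq> {}" using luxemburg_set_nonempty[OF F \<Omega> g] by (auto simp: S_def)
  \<comment> \<open>A single admissible constant makes the \<open>q\<close>-norm finite, so it can
    be compared with \<open>Inf S\<close> as a real number.\<close>
  then obtain c0 where "c0 \<in> S" by blast
  then obtain r where r: "epow G (1 / q) = ennreal r" "r \<ge> 0"
    using le by (cases "epow G (1 / q)") (auto simp: top_unique)
  have "r / b powr (- 1 / q) \<le> Inf S"
  proof (rule cInf_greatest[OF \<open>S \<noteq> {}\<close>])
    fix c assume c: "c \<in> S"
    then have "c > 0" by (simp add: S_def)
    have "ennreal r \<le> ennreal (b powr (- 1 / q) * c)" using le[OF c] r by simp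
    then have "r \<le> b powr (- 1 / q) * c" using \<open>c > 0\<close> by (subst (asm) ennreal_le_iff) auto
    then show "r / b powr (- 1 / q) \<le> c" using b by (simp add: field_simps)
  qed
  then have "r \<le> b powr (- 1 / q) * Inf S" using b by (simp add: field_simps)
  then show ?thesis unfolding G_def[symmetric] r luxemburg_norm_def S_def[symmetric] by (rule ennreal_leI)
qed

section \<open>The weighted inequality\<close>

theorem theorem1p2:
  fixes \<Phi> :: "real \<Rightarrow> real"
  assumes N2: "CARD('n::finite) \<ge> 2"
    and young: "young_function \<Phi>" and d2: "delta2 \<Phi>"
    and dprime: "delta_prime \<Phi>"
    and dprime_conj: "delta_prime_e (young_conj \<Phi>)"
    and B_finite: "\<forall>t\<ge>0. B_Phi CARD('n) \<Phi> t < \<infinity>"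
    and B_young: "young_function (B_Phi_real CARD('n) \<Phi>)"
    and B_d2: "delta2 (B_Phi_real CARD('n) \<Phi>)"
  shows "\<exists>C>0. \<forall>(\<Omega>::(real^'n) set) g u Du.
           open \<Omega> \<longrightarrow>
           (emeasure lebesgue \<Omega> = \<infinity> \<longrightarrow>
              (\<integral>\<^sup>+ s\<in>{0<..1}. ennreal ((s / \<Phi> s) powr (1 / (real CARD('n) - 1))) \<partial>lborel) < \<infinity>) \<longrightarrow>
           g \<in> orlicz_space (young_conj (B_Phi_real CARD('n) \<Phi>)) \<Omega> \<longrightarrow>
           C1c_with_grad \<Omega> u Du \<longrightarrow>
           (\<integral>\<^sup>+ x\<in>\<Omega>. ennreal (\<bar>g x\<bar> * \<Phi> \<bar>u x\<bar>) \<partial>lebesgue)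
             \<le> ennreal C * ennreal (luxemburg_norm (young_conj (B_Phi_real CARD('n) \<Phi>)) \<Omega> g)
                * (\<integral>\<^sup>+ x\<in>\<Omega>. ennreal (\<Phi> (norm (Du x))) \<partial>lebesgue)"
proof -
  define N where "N = real CARD('n)"
  obtain p k K where p: "1 < p" and k: "0 < k" and K: "0 < K" 
    and lo: "\<And>t. 0 \<le> t \<Longrightarrow> k * t powr p \<le> \<Phi> t" and up: "\<And>t. 0 \<le> t \<Longrightarrow> \<Phi> t \<le> K * t powr p"
    using multiplicative_young_function_power[OF young dprime dprime_conj] by blast
  obtain b where pN: "p < N" and b: "b > 0"
    "\<And>t. t \<ge> 0 \<Longrightarrow> ennreal (b * t powr (N / p)) \<le> young_conj (B_Phi_real CARD('n) \<Phi>) t"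
    unfolding N_def using B_Phi_conj_power_lower[OF young p k K lo up N2 B_young] by blast
  define q where "q = N / p"
  define ps where "ps = N * p / (N - p)"
  define M where "M = b powr (- 1 / q)"
  define S where "S = (p * (N - 1) / (N - p)) powr p"
  have q: "q > 1" using p pN by (simp add: q_def)
  \<comment> \<open>Thus \<open>1 / q\<close> and \<open>p / ps\<close> are the two weights in
    Hoelder's inequality for \<open>\<bar>g\<bar>\<close> and
    \<open>\<bar>u\<bar> powr p\<close>.\<close>
  have ps: "ps > 0" "1 - 1 / q = p / ps" using p pN by (auto simp: ps_def q_def field_simps)
  have M: "M > 0" using b by (simp add: M_def)
  have S: "S > 0" using p pN by (simp add: S_def)
  \<comment> \<open>The factors come from \<Phi> bounded above by a power (\<open>K\<close>), the
    Luxemburg norm (\<open>M\<close>), the Sobolev inequality (\<open>S\<close>) and the return from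
    the power to \<Phi> (\<open>1 / k\<close>). All are fixed before \<Omega>, \<open>g\<close> and
    \<open>u\<close>.\<close>
  show ?thesis
  proof (intro exI[of _ "K * M * S / k"] conjI allI impI)
    show "0 < K * M * S / k" using K M S k by simp
    fix \<Omega> :: "(real^'n) set" and g u Du
    assume "open \<Omega>" and g: "g \<in> orlicz_space (young_conj (B_Phi_real CARD('n) \<Phi>)) \<Omega>" and u: "C1c_with_grad \<Omega> u Du"
    define Lux where "Lux = luxemburg_norm (young_conj (B_Phi_real CARD('n) \<Phi>)) \<Omega> g"
    have \<Omega>: "\<Omega> \<in> sets lebesgue" using \<open>open \<Omega>\<close> by (auto intro: lmeasurable_open)
    have "continuous_on UNIV u"
      using u unfolding C1c_with_grad_def by (meson continuous_at_imp_continuous_on has_derivative_continuous)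
    then have u_borel: "u \<in> borel_measurable borel" by (rule borel_measurable_continuous_onI)
    then have um: "u \<in> borel_measurable lebesgue" by (intro measurable_completion) simp
    define gq where "gq x = ennreal (\<bar>g x\<bar> powr q) * indicator \<Omega> x" for x
    have gqm: "gq \<in> borel_measurable lebesgue"
      unfolding gq_def using g
      by (intro borel_measurable_compose_indicator[OF \<Omega>, where g = g and h = "\<lambda>t. ennreal (\<bar>t\<bar> powr q)"])
         (simp_all add: orlicz_space_def)
    have upm: "(\<lambda>x. ennreal (\<bar>u x\<bar> powr ps)) \<in> borel_measurable lebesgue" using um by measurable
    define D where "D = (\<integral>\<^sup>+ x. ennreal (norm (Du x) powr p) \<partial>lebesgue)"
    define R where "R = (\<integral>\<^sup>+ x\<in>\<Omega>. ennreal (\<Phi> (norm (Du x))) \<partial>lebesgue)"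
    have DR: "D \<le> ennreal (1 / k) * R"
    proof -
      have "Du \<in> borel_measurable borel"
        using u unfolding C1c_with_grad_def by (blast intro: borel_measurable_continuous_onI)
      then have "(\<lambda>x. ennreal (norm (Du x) powr p)) \<in> borel_measurable lborel" by measurable
      then have "ennreal k * D = (\<integral>\<^sup>+ x. ennreal k * ennreal (norm (Du x) powr p) \<partial>lebesgue)"
        unfolding D_def nn_integral_completion by (rule nn_integral_cmult[symmetric])
      also have "\<dots> \<le> R"
        unfolding R_def
      proof (intro nn_integral_mono)
        fix x
        show "ennreal k * ennreal (norm (Du x) powr p) \<le> ennreal (\<Phi> (norm (Du x))) * indicator \<Omega> x"
        proof (cases "x \<in> \<Omega>")
          case True
          then show ?thesis using lo[of "norm (Du x)"] k by (simp add: ennreal_mult[symmetric] ennreal_leI)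
        qed (use C1c_grad_outside[OF u, of x] in simp)
      qed
      finally have "ennreal (1 / k) * (ennreal k * D) \<le> ennreal (1 / k) * R" by (rule mult_left_mono) simp
      moreover have "ennreal (1 / k) * ennreal k = 1" using k by (simp flip: ennreal_mult)
      ultimately show ?thesis by (simp only: mult.assoc[symmetric] mult_1)
    qed
    have "(\<integral>\<^sup>+ x\<in>\<Omega>. ennreal (\<bar>g x\<bar> * \<Phi> \<bar>u x\<bar>) \<partial>lebesgue)
       \<le> (\<integral>\<^sup>+ x. ennreal K * (epow (gq x) (1 / q) * epow (ennreal (\<bar>u x\<bar> powr ps)) (p / ps)) \<partial>lebesgue)"
    proof (intro nn_integral_mono)
      fix x
      show "ennreal (\<bar>g x\<bar> * \<Phi> \<bar>u x\<bar>) * indicator \<Omega> x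
        \<le> ennreal K * (epow (gq x) (1 / q) * epow (ennreal (\<bar>u x\<bar> powr ps)) (p / ps))"
      proof (cases "x \<in> \<Omega>")
        case True
        have "epow (gq x) (1 / q) = ennreal \<bar>g x\<bar>" using True q by (simp add: gq_def powr_powr)
        moreover have "epow (ennreal (\<bar>u x\<bar> powr ps)) (p / ps) = ennreal (\<bar>u x\<bar> powr p)"
          using p ps by (simp add: powr_powr)
        moreover have "\<bar>g x\<bar> * \<Phi> \<bar>u x\<bar> \<le> K * (\<bar>g x\<bar> * \<bar>u x\<bar> powr p)"
          using mult_left_mono[OF up[of "\<bar>u x\<bar>"], of "\<bar>g x\<bar>"] by (simp add: ac_simps)
        ultimately show ?thesis using True K by (simp add: ennreal_mult[symmetric] ennreal_leI)
      qed simp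
    qed
    also have "\<dots> = ennreal K * (\<integral>\<^sup>+ x. epow (gq x) (1 / q) * epow (ennreal (\<bar>u x\<bar> powr ps)) (p / ps) \<partial>lebesgue)"
      by (intro nn_integral_cmult borel_measurable_times_ennreal measurable_epow gqm upm)
    also have "\<dots> \<le> ennreal K * (epow (\<integral>\<^sup>+ x. gq x \<partial>lebesgue) (1 / q)
        * epow (\<integral>\<^sup>+ x. ennreal (\<bar>u x\<bar> powr ps) \<partial>lebesgue) (p / ps))"
      using q ps p by (intro mult_left_mono nn_integral_Holder2 gqm upm) auto
    also have "\<dots> \<le> ennreal K * (ennreal (M * Lux) * (ennreal S * D))"
    proof (intro mult_left_mono mult_mono)
      show "epow (\<integral>\<^sup>+ x. gq x \<partial>lebesgue) (1 / q) \<le> ennreal (M * Lux)"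
        unfolding gq_def M_def Lux_def using b q
        by (intro luxemburg_norm_power_bound \<Omega> g) (auto simp: q_def B_Phi_real_def)
      show "epow (\<integral>\<^sup>+ x. ennreal (\<bar>u x\<bar> powr ps) \<partial>lebesgue) (p / ps)
        \<le> ennreal S * D"
        \<comment> \<open>\<open>lebesgue\<close> is the completion of \<open>lborel\<close>, so
          these are the integrals of the Sobolev inequality.\<close>
        unfolding D_def nn_integral_completion ps_def S_def N_def
        using Gagliardo_Nirenberg_Sobolev[OF _ p _ u] N2 pN by (simp add: N_def)
    qed auto
    also have "\<dots> \<le> ennreal K * (ennreal (M * Lux) * (ennreal S * (ennreal (1 / k) * R)))"
      by (intro mult_left_mono DR) auto
    also have "\<dots> = ennreal (K * M * S / k) * ennreal Lux * R"
    proof -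
      have "ennreal (K * M * S / k) = ennreal K * ennreal M * ennreal S * ennreal (1 / k)"
        using K M S k by (simp flip: ennreal_mult)
      moreover have "ennreal (M * Lux) = ennreal M * ennreal Lux" using M by (simp add: ennreal_mult')
      ultimately show ?thesis by (simp only: ac_simps)
    qed
    finally show "(\<integral>\<^sup>+ x\<in>\<Omega>. ennreal (\<bar>g x\<bar> * \<Phi> \<bar>u x\<bar>) \<partial>lebesgue)
      \<le> ennreal (K * M * S / k) * ennreal (luxemburg_norm (young_conj (B_Phi_real CARD('n) \<Phi>)) \<Omega> g)
         * (\<integral>\<^sup>+ x\<in>\<Omega>. ennreal (\<Phi> (norm (Du x))) \<partial>lebesgue)" unfolding Lux_def R_def .
  qed
qed

end
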